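(* Let $G$ be a finitely generated nilpotent-by-abelian-by-finite group. Suppose that $G$ satisfies the maximal condition on virtually cyclic subgroups and has only finitely many conjugacy classes of maximal virtually cyclic subgroups. Then $G$ is virtually cyclic.
   Context: A virtually cyclic group is one with a cyclic subgroup of finite index (finite groups are included). The maximal condition on virtually cyclic subgroups means that every ascending chain of virtually cyclic subgroups of $G$ stabilizes. A group is nilpotent-by-abelian-by-finite if it has a normal subgroup $H$ of finite index such that $H$ has a nilpotent normal subgroup $N$ with $H/N$ abelian. *)

theory Defs
  imports "HOL-Algebra.Algebra"
begin

definition finitely_generated :: "('a, 'b) monoid_scheme \<Rightarrow> bool" where
  "finitely_generated G \<longleftrightarrow>
     (\<exists>S. finite S \<and> S \<subseteq> carrier G \<and> generate G S = carrier G)"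

definition finite_index :: "'a set \<Rightarrow> ('a, 'b) monoid_scheme \<Rightarrow> bool" where
  "finite_index H G \<longleftrightarrow> subgroup H G \<and> finite (rcosets\<^bsub>G\<^esub> H)"

definition virtually_cyclic :: "('a, 'b) monoid_scheme \<Rightarrow> bool" where
  "virtually_cyclic G \<longleftrightarrow> (\<exists>C. finite_index C G \<and> cyclic_group (G\<lparr>carrier := C\<rparr>))"

primrec lower_central :: "('a, 'b) monoid_scheme \<Rightarrow> nat \<Rightarrow> 'a set" where
  "lower_central G 0 = carrier G"
| "lower_central G (Suc n) =
     generate G (\<Union>x \<in> lower_central G n. \<Union>y \<in> carrier G.
       {x \<otimes>\<^bsub>G\<^esub> y \<otimes>\<^bsub>G\<^esub> inv\<^bsub>G\<^esub> x \<otimes>\<^bsub>G\<^esub> inv\<^bsub>G\<^esub> y})"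

definition nilpotent_group :: "('a, 'b) monoid_scheme \<Rightarrow> bool" where
  "nilpotent_group G \<longleftrightarrow> (\<exists>n. lower_central G n = {\<one>\<^bsub>G\<^esub>})"

definition nilpotent_by_abelian :: "('a, 'b) monoid_scheme \<Rightarrow> bool" where
  "nilpotent_by_abelian G \<longleftrightarrow>
     (\<exists>N. N \<lhd> G \<and> nilpotent_group (G\<lparr>carrier := N\<rparr>) \<and> comm_group (G Mod N))"

definition nilpotent_by_abelian_by_finite :: "('a, 'b) monoid_scheme \<Rightarrow> bool" where
  "nilpotent_by_abelian_by_finite G \<longleftrightarrow>
     (\<exists>H. H \<lhd> G \<and> finite_index H G \<and> nilpotent_by_abelian (G\<lparr>carrier := H\<rparr>))"

definition vc_subgroups :: "('a, 'b) monoid_scheme \<Rightarrow> 'a set set" where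
  "vc_subgroups G = {H. subgroup H G \<and> virtually_cyclic (G\<lparr>carrier := H\<rparr>)}"

definition max_condition_vc :: "('a, 'b) monoid_scheme \<Rightarrow> bool" where
  "max_condition_vc G \<longleftrightarrow>
     (\<forall>K :: nat \<Rightarrow> 'a set.
        (\<forall>n. K n \<in> vc_subgroups G) \<and> (\<forall>n. K n \<subseteq> K (Suc n)) \<longrightarrow>
        (\<exists>m. \<forall>n\<ge>m. K n = K m))"

definition maximal_vc_subgroups :: "('a, 'b) monoid_scheme \<Rightarrow> 'a set set" where
  "maximal_vc_subgroups G =
     {M \<in> vc_subgroups G. \<forall>K \<in> vc_subgroups G. M \<subseteq> K \<longrightarrow> K = M}"

definition conjugacy_class :: "('a, 'b) monoid_scheme \<Rightarrow> 'a set \<Rightarrow> 'a set set" where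
  "conjugacy_class G H = {g <#\<^bsub>G\<^esub> H #>\<^bsub>G\<^esub> inv\<^bsub>G\<^esub> g | g. g \<in> carrier G}"

end

theory Submission
  imports Defs "HOL-Number_Theory.Cong"
begin

text \<open>By the maximal condition every element of G lies in a maximal virtually cyclic subgroup, so
  the conjugates of finitely many virtually cyclic subgroups V_1, ..., V_n cover G.  The proof
  plays this covering off against the growth of quotients of modules over the ring R of integral
  Laurent polynomials in one variable t.

  Let M be a subgroup and t an element that normalises M and has no nontrivial power in M, and
  suppose that the product M T, where T is generated by t, has finite index in G.  A virtually
  cyclic group that meets a coset M t^k with k > 0 meets M in a finite group, so each V_i
  contributes boundedly many elements to each such coset.  Hence the number of classes of
  M t^k under conjugation by M T is at most a constant c that does not depend on k
  (\<open>bounded_classes_of_cover\<close>).  Now let C be a t-invariant normal subgroup of M such that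
  A = M/C is abelian and generated by one element as an R-module, the variable acting by
  conjugation.  In additive notation, conjugation by y t^j turns the element e t^k into the element
  (t^j e + (1 - t^k) y) t^k.  Modulo t^k - 1 only the remainder of j modulo k matters, so
  A/(t^k - 1)A has at most c k elements, for every k > 0.

  Such a module A = R/I is finite (\<open>laurent_quotient_finite\<close>).  First, comparing the bound
  with the 2^k sums of distinct monomials among 1, ..., t^(k-1) yields an element P of I
  whose coefficients have no common prime divisor, and therefore A/nA is finite for every n > 0.
  Secondly, let n be a product of s distinct odd primes that are not invertible in A.  The
  integers have 2^s square roots of 1 modulo n, and these stay distinct in A/nA.  By the pigeonhole
  principle some t^d with 0 < d and 2^s d not larger than the order of A/nA acts on A/nA as one of
  them, so t^(2d) - 1 annihilates A/nA; this gives that A/nA has at most 2 c d elements, and so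
  2^s is at most 2c.  Consequently all but boundedly many primes are invertible in A.  Choose
  such a prime p that divides neither the first nor the last coefficient of P.  Because of P, the
  localisation of A at p is finitely generated over the localised integers, and multiplication by p
  is surjective on it.  So A is killed by a nonzero integer N, and A = A/NA is finite.

  If M T is finitely generated, then the abelianisation of M is a finitely generated R-module, and
  removing one generator at a time shows that it is finite (\<open>derived_finite_index\<close>).  The
  derived subgroup of M is again normalised by t, so by induction on the derived length M is
  finite whenever it is solvable (\<open>finite_kernel_of_solvable\<close>).

  The subgroup H of finite index supplied by the hypothesis is finitely generated, and it is
  solvable because the derived series of a nilpotent group lies below its lower central series.
  Follow the derived series of H as long as each term has finite index in the preceding one.  If
  this leads down to the trivial group, then G is finite.  Otherwise one of the terms is a finitely
  generated subgroup K of finite index in G with infinite abelianisation.  Then there are M and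
  t as above with M T of finite index in K (\<open>infinite_abelianization_step\<close>), and since M is
  finite, T is a cyclic subgroup of finite index in G.\<close>

section \<open>Ideals and residue classes\<close>

definition zmodule :: "'a::ab_group_add set \<Rightarrow> bool" where
  "zmodule W \<longleftrightarrow> 0 \<in> W \<and> (\<forall>x\<in>W. \<forall>y\<in>W. x - y \<in> W)"

definition ring_ideal :: "'a::comm_ring_1 set \<Rightarrow> bool" where
  "ring_ideal I \<longleftrightarrow> zmodule I \<and> (\<forall>r. \<forall>x\<in>I. r * x \<in> I)"

definition residue_class :: "'a::ab_group_add set \<Rightarrow> 'a \<Rightarrow> 'a set" where
  "residue_class W x = {y. y - x \<in> W}"

definition ideal_plus :: "'a::comm_ring_1 set \<Rightarrow> 'a \<Rightarrow> 'a set" where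
  "ideal_plus I a = {x + a * r | x r. x \<in> I}"

lemma zmodule_zero: "zmodule W \<Longrightarrow> 0 \<in> W"
  and zmodule_diff: "zmodule W \<Longrightarrow> x \<in> W \<Longrightarrow> y \<in> W \<Longrightarrow> x - y \<in> W"
  by (auto simp: zmodule_def)

lemma zmodule_minus: "zmodule W \<Longrightarrow> x \<in> W \<Longrightarrow> - x \<in> W"
  using zmodule_diff[of W 0 x] zmodule_zero[of W] by simp

lemma zmodule_add: "zmodule W \<Longrightarrow> x \<in> W \<Longrightarrow> y \<in> W \<Longrightarrow> x + y \<in> W"
  using zmodule_diff[of W x "- y"] zmodule_minus[of W y] by simp

lemma zmodule_sum: "zmodule W \<Longrightarrow> (\<And>i. i \<in> A \<Longrightarrow> f i \<in> W) \<Longrightarrow> sum f A \<in> W"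
  by (induction A rule: infinite_finite_induct) (auto intro: zmodule_zero zmodule_add)

lemma zmodule_of_int_mult:
  fixes x :: "'a::comm_ring_1"
  assumes "zmodule W" "x \<in> W"
  shows "of_int n * x \<in> W"
proof (induction n rule: int_induct[where k = 0])
  case base
  then show ?case using zmodule_zero[OF assms(1)] by simp
next
  case (step1 i)
  then show ?case using zmodule_add[OF assms(1) _ assms(2)] by (simp add: distrib_right)
next
  case (step2 i)
  then show ?case using zmodule_diff[OF assms(1) _ assms(2)] by (simp add: left_diff_distrib)
qed

lemma ring_ideal_zmodule: "ring_ideal I \<Longrightarrow> zmodule I"
  and ring_ideal_mult: "ring_ideal I \<Longrightarrow> x \<in> I \<Longrightarrow> r * x \<in> I"
  by (auto simp: ring_ideal_def)

lemma ideal_plus_ideal: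
  assumes "ring_ideal I"
  shows "ring_ideal (ideal_plus I a)"
  unfolding ring_ideal_def zmodule_def
proof (intro conjI ballI allI)
  note I = ring_ideal_zmodule[OF assms]
  show "0 \<in> ideal_plus I a"
    unfolding ideal_plus_def using zmodule_zero[OF I] by (force intro: exI[of _ 0])
next
  note I = ring_ideal_zmodule[OF assms]
  fix x y assume "x \<in> ideal_plus I a" "y \<in> ideal_plus I a"
  then obtain u r v s where "x = u + a * r" "y = v + a * s" "u \<in> I" "v \<in> I"
    unfolding ideal_plus_def by blast
  then have "x - y = (u - v) + a * (r - s)" "u - v \<in> I"
    by (auto simp: algebra_simps zmodule_diff[OF I])
  then show "x - y \<in> ideal_plus I a" unfolding ideal_plus_def by blast
next
  fix r x assume "x \<in> ideal_plus I a"
  then obtain u s where "x = u + a * s" "u \<in> I"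
    unfolding ideal_plus_def by blast
  then have "r * x = r * u + a * (r * s)" "r * u \<in> I"
    by (auto simp: algebra_simps ring_ideal_mult[OF assms])
  then show "r * x \<in> ideal_plus I a" unfolding ideal_plus_def by blast
qed

lemma ideal_subset_ideal_plus: "I \<subseteq> ideal_plus I a"
  unfolding ideal_plus_def by (force intro: exI[of _ 0])

lemma mult_in_ideal_plus: "ring_ideal I \<Longrightarrow> a * r \<in> ideal_plus I a"
  unfolding ideal_plus_def using zmodule_zero[OF ring_ideal_zmodule] by force

lemma ideal_plus_least:
  assumes "ring_ideal J" "I \<subseteq> J" "a \<in> J"
  shows "ideal_plus I a \<subseteq> J"
proof
  fix x assume "x \<in> ideal_plus I a"
  then obtain u r where "x = u + r * a" "u \<in> I" unfolding ideal_plus_def by (auto simp: mult.commute)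
  then show "x \<in> J"
    using assms ring_ideal_mult[OF assms(1,3)] zmodule_add[OF ring_ideal_zmodule[OF assms(1)]] by blast
qed

lemma residue_class_eq_iff:
  assumes "zmodule W"
  shows "residue_class W x = residue_class W y \<longleftrightarrow> x - y \<in> W"
proof
  assume "residue_class W x = residue_class W y"
  moreover have "x \<in> residue_class W x" by (simp add: residue_class_def zmodule_zero[OF assms])
  ultimately show "x - y \<in> W" by (simp add: residue_class_def)
next
  assume xy: "x - y \<in> W"
  have "z - x \<in> W \<longleftrightarrow> z - y \<in> W" for z
    using zmodule_add[OF assms _ xy, of "z - x"] zmodule_diff[OF assms _ xy, of "z - y"] by auto
  then show "residue_class W x = residue_class W y" by (auto simp: residue_class_def)
qed

lemma residue_classes_le_cover:
  assumes "zmodule W" "finite Y" "\<And>x. \<exists>y\<in>Y. x - y \<in> W"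
  shows "finite (range (residue_class W))" "card (range (residue_class W)) \<le> card Y"
proof -
  have "range (residue_class W) \<subseteq> residue_class W ` Y"
    using assms(3) residue_class_eq_iff[OF assms(1)] by blast
  then show "finite (range (residue_class W))" "card (range (residue_class W)) \<le> card Y"
    using assms(2) by (meson finite_imageI finite_subset, meson card_image_le card_mono finite_imageI le_trans)
qed

lemma residue_classes_cover:
  assumes "zmodule W" "finite (range (residue_class W))"
  obtains Y where "finite Y" "\<And>x. \<exists>y\<in>Y. x - y \<in> W"
proof -
  obtain Y where Y: "finite Y" "range (residue_class W) = residue_class W ` Y"
    using finite_subset_image[OF assms(2), of "residue_class W" UNIV] by blast
  have "\<exists>y\<in>Y. x - y \<in> W" for x
    using Y(2) residue_class_eq_iff[OF assms(1)] by (metis imageE rangeI)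
  with Y(1) that show thesis by blast
qed

section \<open>Finite quotients of the ring of Laurent polynomials\<close>

text \<open>With convolution as multiplication, the finitely supported integral functions on the integers form
  the ring of Laurent polynomials.  The power of the variable t with exponent i is \<open>frag_of i\<close>.\<close>

lemma of_int_mult_frag_of: "of_int c * (frag_of i :: int \<Rightarrow>\<^sub>0 int) = Poly_Mapping.single i c"
  by (metis add_0 mult.right_neutral mult_single single_of_int of_int_eq_id id_apply)

lemma laurent_expansion:
  fixes P :: "int \<Rightarrow>\<^sub>0 int"
  assumes "finite A" "Poly_Mapping.keys P \<subseteq> A"
  shows "P = (\<Sum>i\<in>A. of_int (Poly_Mapping.lookup P i) * frag_of i)"
proof -
  have "Poly_Mapping.lookup (\<Sum>i\<in>A. Poly_Mapping.single i (Poly_Mapping.lookup P i)) j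
     = Poly_Mapping.lookup P j" for j
    using assms by (auto simp: lookup_sum lookup_single when_def sum.delta in_keys_iff)
  then show ?thesis by (simp add: poly_mapping_eqI of_int_mult_frag_of)
qed

lemma frag_of_mult: "frag_of i * frag_of j = (frag_of (i + j) :: 'a::monoid_add \<Rightarrow>\<^sub>0 int)"
  by (simp add: mult_single)

lemma zmodule_with_monomials:
  fixes V :: "(int \<Rightarrow>\<^sub>0 int) set"
  assumes "zmodule V" "\<And>i. frag_of i \<in> V"
  shows "x \<in> V"
  using subset_UNIV
  by (induction x rule: frag_induction) (auto intro: assms zmodule_zero zmodule_diff)

text \<open>A relation P expresses the monomial at either end of a shifted copy of P through the
  other ones, up to its extreme coefficients.  So a group V that contains as many consecutive
  monomials as the width of P, and in which these coefficients can be cancelled, contains all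
  monomials.  The lemma is applied with three different groups V, in each of which the
  coefficients can be cancelled for a different reason.\<close>

lemma laurent_reduction:
  fixes P :: "int \<Rightarrow>\<^sub>0 int"
  assumes J: "ring_ideal J" "P \<in> J" and V: "zmodule V" "J \<subseteq> V"
    and keys: "l \<le> h" "Poly_Mapping.keys P \<subseteq> {l..h}"
    and cancel_h: "\<And>x. of_int (Poly_Mapping.lookup P h) * x \<in> V \<Longrightarrow> x \<in> V"
    and cancel_l: "\<And>x. of_int (Poly_Mapping.lookup P l) * x \<in> V \<Longrightarrow> x \<in> V"
    and base: "\<And>i. l \<le> i \<Longrightarrow> i < h \<Longrightarrow> frag_of i \<in> V"
  shows "x \<in> V"
proof (rule zmodule_with_monomials[OF V(1)])
  let ?c = "Poly_Mapping.lookup P"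
  have shift: "(\<Sum>i\<in>{l..h}. of_int (?c i) * frag_of (n + i)) \<in> V" for n
  proof -
    have "frag_of n * P \<in> V" using J V(2) ring_ideal_mult by blast
    moreover have "frag_of n * P = (\<Sum>i\<in>{l..h}. of_int (?c i) * frag_of (n + i))"
      by (subst laurent_expansion[OF _ keys(2)])
         (simp_all add: sum_distrib_left frag_of_mult[symmetric] algebra_simps)
    ultimately show ?thesis by simp
  qed
  have isolate: "of_int (?c j) * frag_of (n + j) \<in> V"
    if "j \<in> {l..h}" "\<And>i. i \<in> {l..h} - {j} \<Longrightarrow> frag_of (n + i) \<in> V" for n j
  proof -
    have "(\<Sum>i\<in>{l..h} - {j}. of_int (?c i) * frag_of (n + i)) \<in> V"
      using that(2) by (intro zmodule_sum V(1) zmodule_of_int_mult)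
    from zmodule_diff[OF V(1) shift[of n] this] that(1) show ?thesis
      by (simp add: sum.remove[of "{l..h}" j])
  qed
  have up: "frag_of (l + int n) \<in> V" for n
  proof (induction n rule: less_induct)
    case (less n)
    show ?case
    proof (cases "l + int n < h")
      case True
      then show ?thesis by (intro base) auto
    next
      case False
      have "frag_of (l + int n - h + i) \<in> V" if "i \<in> {l..h} - {h}" for i
        using less[of "nat (int n - h + i)"] that False by (auto simp: algebra_simps)
      then show ?thesis using isolate[of h "l + int n - h"] cancel_h keys(1) by auto
    qed
  qed
  have down: "frag_of (l - int n) \<in> V" for n
  proof (induction n rule: less_induct)
    case (less n)
    have "frag_of (- int n + i) \<in> V" if "i \<in> {l..h} - {l}" for i
    proof (cases "- int n + i \<ge> l")
      case True
      then show ?thesis using up[of "nat (i - int n - l)"] by (simp add: algebra_simps)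
    next
      case False
      then show ?thesis using less[of "nat (l - (i - int n))"] that by (auto simp: algebra_simps)
    qed
    then have "of_int (?c l) * frag_of (- int n + l) \<in> V"
      using isolate[of l "- int n"] keys(1) by auto
    then show ?case using cancel_l by (simp add: algebra_simps)
  qed
  show "frag_of i \<in> V" for i
    using up[of "nat (i - l)"] down[of "nat (l - i)"] by (cases "i \<ge> l") auto
qed

text \<open>There are more sums of distinct monomials among 1, ..., t^(k-1) than residue classes modulo
  I + (t^k - 1), so the difference of two such sums is congruent to some P in I modulo t^k - 1.
  Folding the exponents modulo k maps P to that difference, which has a coefficient 1 or -1.
  A common divisor of the coefficients of P survives the folding, hence it is a unit.\<close>

lemma primitive_relation:
  fixes I :: "(int \<Rightarrow>\<^sub>0 int) set"
  assumes I: "ring_ideal I" and k: "k > 0"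
    and Y: "finite Y" "card Y < 2 ^ k" "\<And>x. \<exists>y\<in>Y. x - y \<in> ideal_plus I (frag_of (int k) - 1)"
  obtains P where "P \<in> I" "\<And>p. \<not> is_unit p \<Longrightarrow> \<exists>i. \<not> p dvd Poly_Mapping.lookup P i"
proof -
  let ?J = "ideal_plus I (frag_of (int k) - 1)"
  have J: "zmodule ?J" using ideal_plus_ideal[OF I] ring_ideal_zmodule by blast
  define f where "f S = (\<Sum>j\<in>S. (frag_of (int j) :: int \<Rightarrow>\<^sub>0 int))" for S
  define fold where "fold = frag_extend (\<lambda>i. (frag_of (i mod int k) :: int \<Rightarrow>\<^sub>0 int))"
  have "card ((\<lambda>S. residue_class ?J (f S)) ` Pow {..<k}) \<le> card (range (residue_class ?J))"
    using residue_classes_le_cover(1)[OF J Y(1,3)] by (intro card_mono) auto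
  also have "\<dots> < 2 ^ k" using residue_classes_le_cover(2)[OF J Y(1,3)] Y(2) by simp
  finally have "\<not> inj_on (\<lambda>S. residue_class ?J (f S)) (Pow {..<k})"
    using card_image[of "\<lambda>S. residue_class ?J (f S)" "Pow {..<k}"] by (auto simp: card_Pow)
  then obtain S S' where S: "S \<subseteq> {..<k}" "S' \<subseteq> {..<k}" "S \<noteq> S'" "f S - f S' \<in> ?J"
    using residue_class_eq_iff[OF J] unfolding inj_on_def by blast
  then obtain P r where P: "P \<in> I" "f S - f S' = P + (frag_of (int k) - 1) * r"
    unfolding ideal_plus_def by blast
  have fold_f: "fold (f A) = f A" if "A \<subseteq> {..<k}" for A
    using that finite_subset[OF that] unfolding fold_def f_def
    by (subst frag_extend_sum) (auto intro!: sum.cong)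
  have "fold (frag_of (int k) * r) = fold r"
    using subset_UNIV
  proof (induction r rule: frag_induction)
    case (diff a b)
    then show ?case by (simp add: fold_def frag_extend_diff right_diff_distrib)
  qed (auto simp: fold_def frag_of_mult)
  then have "fold ((frag_of (int k) - 1) * r) = 0"
    by (simp add: fold_def frag_extend_diff left_diff_distrib)
  then have foldP: "fold P = f S - f S'"
    using arg_cong[OF P(2), of fold] fold_f S(1,2)
    by (simp add: fold_def frag_extend_diff frag_extend_add)
  have lookup_f: "Poly_Mapping.lookup (f A) (int j) = (if j \<in> A then 1 else 0)"
    if "A \<subseteq> {..<k}" for A j
    using finite_subset[OF that] by (auto simp: f_def lookup_sum)
  obtain j where j: "j \<in> S \<longleftrightarrow> j \<notin> S'" using S(3) by blast
  have "\<exists>i. \<not> p dvd Poly_Mapping.lookup P i" if "\<not> is_unit p" for p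
  proof (rule ccontr)
    assume "\<not> ?thesis"
    then have "p dvd Poly_Mapping.lookup (fold P) (int j)"
      by (auto simp: fold_def frag_extend_def lookup_sum intro!: dvd_sum)
    then show False
      using that j lookup_f[OF S(1)] lookup_f[OF S(2)] by (auto simp: foldP lookup_minus split: if_splits)
  qed
  with P(1) that show thesis by blast
qed

definition int_span_mod :: "'a::comm_ring_1 set \<Rightarrow> ('i \<Rightarrow> 'a) \<Rightarrow> 'i set \<Rightarrow> 'a set" where
  "int_span_mod I b A = {x. \<exists>c. x - (\<Sum>i\<in>A. of_int (c i) * b i) \<in> I}"

lemma int_span_mod_zmodule:
  assumes "zmodule I"
  shows "zmodule (int_span_mod I b A)"
  unfolding zmodule_def
proof (intro conjI ballI)
  show "0 \<in> int_span_mod I b A"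
    using zmodule_zero[OF assms] by (auto simp: int_span_mod_def intro!: exI[of _ "\<lambda>_. 0"])
next
  fix x y assume "x \<in> int_span_mod I b A" "y \<in> int_span_mod I b A"
  then obtain c d where
    "x - (\<Sum>i\<in>A. of_int (c i) * b i) \<in> I" "y - (\<Sum>i\<in>A. of_int (d i) * b i) \<in> I"
    by (auto simp: int_span_mod_def)
  from zmodule_diff[OF assms this]
  have "(x - y) - (\<Sum>i\<in>A. of_int (c i - d i) * b i) \<in> I"
    by (simp add: algebra_simps sum_subtractf)
  then show "x - y \<in> int_span_mod I b A"
    unfolding int_span_mod_def by (intro CollectI exI[of _ "\<lambda>i. c i - d i"])
qed

lemma int_span_mod_base: "I \<subseteq> int_span_mod I b A"
proof
  fix x assume "x \<in> I"
  then show "x \<in> int_span_mod I b A"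
    unfolding int_span_mod_def by (intro CollectI exI[of _ "\<lambda>_. 0"]) simp
qed

lemma int_span_mod_generator:
  assumes "zmodule I" "finite A" "i \<in> A"
  shows "b i \<in> int_span_mod I b A"
proof -
  have "(\<Sum>j\<in>A. of_int (if j = i then 1 else 0) * b j) = b i"
    using assms(2,3) by (subst sum.remove[of A i]) (auto intro!: sum.neutral)
  then show ?thesis
    unfolding int_span_mod_def using zmodule_zero[OF assms(1)]
    by (intro CollectI exI[of _ "\<lambda>j. if j = i then 1 else 0"]) simp
qed

lemma cancel_prime_to:
  fixes x :: "'a::comm_ring_1"
  assumes "zmodule V" "Factorial_Ring.prime p" "\<not> p dvd c" "of_int c * x \<in> V" "of_int p * x \<in> V"
  shows "x \<in> V"
proof -
  have "coprime c p" using assms(2,3) prime_imp_coprime coprime_commute by blast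
  then obtain u v where "u * c + v * p = 1" using bezout_int[of c p] by (auto simp: coprime_iff_gcd_eq_1)
  then have "x = of_int u * (of_int c * x) + of_int v * (of_int p * x)"
    by (metis distrib_right mult.assoc mult_1 of_int_1 of_int_add of_int_mult)
  then show ?thesis
    using zmodule_add[OF assms(1)] zmodule_of_int_mult[OF assms(1)] assms(4,5) by metis
qed

text \<open>Once the terms divisible by p are dropped from P, its extreme coefficients are units modulo p.
  So the monomials between the two ends span the quotient over the field with p elements.\<close>

lemma finite_residues_mod_prime:
  fixes I :: "(int \<Rightarrow>\<^sub>0 int) set"
  assumes I: "ring_ideal I" "P \<in> I" and p: "Factorial_Ring.prime p" "\<not> p dvd Poly_Mapping.lookup P i0"
  shows "finite (range (residue_class (ideal_plus I (of_int p))))"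
proof -
  let ?J = "ideal_plus I (of_int p)" and ?c = "Poly_Mapping.lookup P"
  define S where "S = {i \<in> Poly_Mapping.keys P. \<not> p dvd ?c i}"
  have J: "ring_ideal ?J" "zmodule ?J"
    using ideal_plus_ideal[OF I(1)] ring_ideal_zmodule by auto
  have pJ: "of_int p * x \<in> ?J" for x by (rule mult_in_ideal_plus[OF I(1)])
  have S: "finite S" "S \<noteq> {}" using p(2) by (auto simp: S_def in_keys_iff intro!: exI[of _ i0])
  define l h where "l = Min S" and "h = Max S"
  have lh: "l \<in> S" "h \<in> S" "S \<subseteq> {l..h}" "l \<le> h" using S by (auto simp: l_def h_def)
  \<comment> \<open>Dropping the terms divisible by p leaves a relation whose extreme coefficients are
      invertible mod p.\<close>
  define P' where "P' = (\<Sum>i\<in>S. of_int (?c i) * (frag_of i :: int \<Rightarrow>\<^sub>0 int))"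
  have "S \<subseteq> Poly_Mapping.keys P" by (auto simp: S_def)
  then have "P - P' = (\<Sum>i\<in>Poly_Mapping.keys P - S. of_int (?c i) * frag_of i)"
    using laurent_expansion[OF finite_keys order_refl, of P]
      sum_diff[OF finite_keys, of S P "\<lambda>i. of_int (?c i) * frag_of i"] by (simp add: P'_def)
  moreover have "of_int (?c i) * frag_of i \<in> ?J" if "i \<in> Poly_Mapping.keys P - S" for i
  proof -
    from that have "p dvd ?c i" by (auto simp: S_def)
    then obtain d where "?c i = p * d" by (rule dvdE)
    then have "of_int (?c i) * frag_of i = of_int p * (of_int d * (frag_of i :: int \<Rightarrow>\<^sub>0 int))"
      by (simp add: mult.assoc)
    then show ?thesis using pJ[of "of_int d * frag_of i"] by (simp only:)
  qed
  ultimately have "P - P' \<in> ?J"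
    using zmodule_sum[OF J(2), of "Poly_Mapping.keys P - S" "\<lambda>i. of_int (?c i) * frag_of i"] by (simp only:)
  with I(2) have P'J: "P' \<in> ?J"
    using zmodule_diff[OF J(2), of P "P - P'"] ideal_subset_ideal_plus[of I "of_int p"] by auto
  have lookupP': "Poly_Mapping.lookup P' i = (if i \<in> S then ?c i else 0)" for i
  proof -
    show ?thesis using S(1)
      by (simp add: of_int_mult_frag_of P'_def lookup_sum lookup_single when_def sum.delta)
  qed
  let ?V = "int_span_mod ?J frag_of {l..<h}"
  have V: "zmodule ?V" by (rule int_span_mod_zmodule[OF J(2)])
  have pV: "of_int p * x \<in> ?V" for x using int_span_mod_base pJ by blast
  have all: "x \<in> ?V" for x
  proof (rule laurent_reduction[OF J(1) P'J V int_span_mod_base lh(4)])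
    show "Poly_Mapping.keys P' \<subseteq> {l..h}"
      using lh(3) by (auto simp: in_keys_iff lookupP' split: if_splits)
    show "of_int (Poly_Mapping.lookup P' h) * x \<in> ?V \<Longrightarrow> x \<in> ?V"
      "of_int (Poly_Mapping.lookup P' l) * x \<in> ?V \<Longrightarrow> x \<in> ?V" for x
      using lh(1,2) cancel_prime_to[OF V p(1) _ _ pV] by (auto simp: lookupP' S_def)
  qed (auto intro: int_span_mod_generator[OF J(2)])
  define Y where "Y = (\<lambda>c. \<Sum>i\<in>{l..<h}. of_int (c i) * (frag_of i :: int \<Rightarrow>\<^sub>0 int)) ` ({l..<h} \<rightarrow>\<^sub>E {0..<p})"
  have "finite Y" unfolding Y_def by (intro finite_imageI finite_PiE) auto
  moreover have "\<exists>y\<in>Y. x - y \<in> ?J" for x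
  proof -
    obtain c where c: "x - (\<Sum>i\<in>{l..<h}. of_int (c i) * frag_of i) \<in> ?J"
      using all[of x] by (auto simp: int_span_mod_def)
    define d where "d = restrict (\<lambda>i. c i mod p) {l..<h}"
    have "of_int (c i) * frag_of i - of_int (d i) * frag_of i
        = of_int p * (of_int (c i div p) * (frag_of i :: int \<Rightarrow>\<^sub>0 int))" if "i \<in> {l..<h}" for i
    proof -
      have "of_int (c i) = of_int p * of_int (c i div p) + (of_int (d i) :: int \<Rightarrow>\<^sub>0 int)"
        using that by (simp add: d_def flip: of_int_mult of_int_add)
      then show ?thesis by (simp add: algebra_simps)
    qed
    then have "(\<Sum>i\<in>{l..<h}. of_int (c i) * frag_of i - of_int (d i) * frag_of i) \<in> ?J"
      using pJ by (intro zmodule_sum J(2)) auto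
    from zmodule_add[OF J(2) c this]
    have "x - (\<Sum>i\<in>{l..<h}. of_int (d i) * frag_of i) \<in> ?J" by (simp add: sum_subtractf)
    moreover have "d \<in> {l..<h} \<rightarrow>\<^sub>E {0..<p}" using p(1) by (auto simp: d_def prime_gt_0_int)
    ultimately show ?thesis unfolding Y_def by blast
  qed
  ultimately show ?thesis using residue_classes_le_cover(1)[OF J(2)] by blast
qed

text \<open>For n = p m, residues modulo n are obtained by composing residues modulo p with residues
  modulo m, as for integers written in a mixed radix.\<close>

lemma finite_residues_mod_int:
  fixes I :: "'a::comm_ring_1 set"
  assumes I: "ring_ideal I"
    and fin: "\<And>p::int. Factorial_Ring.prime p \<Longrightarrow> finite (range (residue_class (ideal_plus I (of_int p))))"
    and "n > (0::nat)"
  shows "finite (range (residue_class (ideal_plus I (of_nat n))))"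
  using \<open>n > 0\<close>
proof (induction n rule: less_induct)
  case (less n)
  have zm: "zmodule (ideal_plus I a)" for a using ideal_plus_ideal[OF I] ring_ideal_zmodule by blast
  show ?case
  proof (cases "n = 1")
    case True
    have "x \<in> ideal_plus I 1" for x using mult_in_ideal_plus[OF I, of 1 x] by simp
    then show ?thesis
      using True residue_classes_le_cover(1)[OF zm, of "{0}" "of_nat n"] by auto
  next
    case False
    then obtain p where p: "Factorial_Ring.prime p" "p dvd n" using prime_factor_nat by blast
    then obtain m where m: "n = p * m" by blast
    with less.prems p(1) have "m < n" "m > 0" using prime_gt_1_nat[of p] by auto
    then obtain Y where Y: "finite Y" "\<And>x. \<exists>y\<in>Y. x - y \<in> ideal_plus I (of_nat m)"
      using residue_classes_cover[OF zm less.IH] by metis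
    have "finite (range (residue_class (ideal_plus I (of_nat p))))"
      using fin[of "int p"] p(1) by simp
    then obtain Z where Z: "finite Z" "\<And>x. \<exists>z\<in>Z. x - z \<in> ideal_plus I (of_nat p)"
      using residue_classes_cover[OF zm] by metis
    have "\<exists>w\<in>(\<lambda>(y, z). z + of_nat p * y) ` (Y \<times> Z). x - w \<in> ideal_plus I (of_nat n)" for x
    proof -
      obtain z i r where z: "z \<in> Z" "i \<in> I" "x - z = i + of_nat p * r"
        using Z(2)[of x] unfolding ideal_plus_def by blast
      obtain y j s where y: "y \<in> Y" "j \<in> I" "r - y = j + of_nat m * s"
        using Y(2)[of r] unfolding ideal_plus_def by blast
      have "r = y + j + of_nat m * s" using y(3) by (simp add: algebra_simps)
      then have "x - (z + of_nat p * y) = (i + of_nat p * j) + of_nat n * s"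
        using z(3) by (simp add: m algebra_simps)
      moreover have "i + of_nat p * j \<in> I"
        using z(2) y(2) ring_ideal_mult[OF I] zmodule_add[OF ring_ideal_zmodule[OF I]] by blast
      ultimately have "x - (z + of_nat p * y) \<in> ideal_plus I (of_nat n)"
        unfolding ideal_plus_def by blast
      with z(1) y(1) show ?thesis by force
    qed
    then show ?thesis
      using residue_classes_le_cover(1)[OF zm, of "(\<lambda>(y, z). z + of_nat p * y) ` (Y \<times> Z)"] Y(1) Z(1) by blast
  qed
qed

text \<open>The hypothesis says that, after localisation at p, the elements b i generate modulo I a group
  on which multiplication by p is surjective.  Nakayama's lemma then makes that
  group trivial.  The proof is Gaussian elimination: the relation for one generator has a diagonal
  coefficient congruent to q modulo p, hence prime to p, and is used to remove this generator
  from the other relations.\<close>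

lemma divisible_span_torsion:
  fixes b :: "'i \<Rightarrow> 'a::comm_ring_1"
  assumes "finite A" and I: "zmodule I" and p: "Factorial_Ring.prime (p::int)"
    and "\<And>i. i \<in> A \<Longrightarrow> \<exists>q c. \<not> p dvd q \<and>
           of_int q * b i - of_int p * (\<Sum>j\<in>A. of_int (c j) * b j) \<in> I"
  shows "\<exists>N. \<not> p dvd N \<and> (\<forall>i\<in>A. of_int N * b i \<in> I)"
  using assms(1,4)
proof (induction A rule: finite_induct)
  case empty
  then show ?case using p by (auto intro!: exI[of _ 1])
next
  case (insert a A)
  obtain q c where qc: "\<not> p dvd q"
    "of_int q * b a - of_int p * (\<Sum>j\<in>insert a A. of_int (c j) * b j) \<in> I"
    using insert.prems[of a] by blast
  define q' where "q' = q - p * c a"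
  have q': "\<not> p dvd q'" using qc(1) by (simp add: q'_def dvd_diff_left_iff)
  have a: "of_int q' * b a - of_int p * (\<Sum>j\<in>A. of_int (c j) * b j) \<in> I"
    using qc(2) insert.hyps by (simp add: q'_def algebra_simps)
  have "\<exists>r e. \<not> p dvd r \<and> of_int r * b i - of_int p * (\<Sum>j\<in>A. of_int (e j) * b j) \<in> I"
    if i: "i \<in> A" for i
  proof -
    obtain r d where rd: "\<not> p dvd r"
      "of_int r * b i - of_int p * (\<Sum>j\<in>insert a A. of_int (d j) * b j) \<in> I"
      using insert.prems[of i] i by blast
    have "of_int q' * (of_int r * b i - of_int p * (\<Sum>j\<in>insert a A. of_int (d j) * b j))
       + of_int (p * d a) * (of_int q' * b a - of_int p * (\<Sum>j\<in>A. of_int (c j) * b j))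
       = of_int (q' * r) * b i - of_int p * (\<Sum>j\<in>A. of_int (q' * d j + p * d a * c j) * b j)"
      using insert.hyps by (simp add: algebra_simps sum.distrib sum_distrib_left)
    then have "of_int (q' * r) * b i - of_int p * (\<Sum>j\<in>A. of_int (q' * d j + p * d a * c j) * b j) \<in> I"
      using zmodule_add[OF I zmodule_of_int_mult[OF I rd(2), of q'] zmodule_of_int_mult[OF I a, of "p * d a"]]
      by simp
    moreover have "\<not> p dvd q' * r" using q' rd(1) p by (simp add: prime_dvd_mult_iff)
    ultimately show ?thesis
      by (intro exI[of _ "q' * r"] exI[of _ "\<lambda>j. q' * d j + p * d a * c j"] conjI)
  qed
  from insert.IH[OF this] obtain N where N: "\<not> p dvd N" "\<forall>i\<in>A. of_int N * b i \<in> I" by blast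
  have "(\<Sum>j\<in>A. of_int (c j) * (of_int N * b j)) \<in> I"
    using N(2) zmodule_of_int_mult[OF I] by (simp add: zmodule_sum[OF I])
  from zmodule_add[OF I zmodule_of_int_mult[OF I a, of N] zmodule_of_int_mult[OF I this, of p]]
  have "of_int (N * q') * b a \<in> I" by (simp add: algebra_simps sum_distrib_left)
  moreover have "of_int (N * q') * b i \<in> I" if "i \<in> A" for i
    using zmodule_of_int_mult[OF I, of "of_int N * b i" q'] N(2) that by (simp add: algebra_simps)
  ultimately show ?case
    using q' N(1) p by (intro exI[of _ "N * q'"]) (auto simp: prime_dvd_mult_iff)
qed

text \<open>If the prime p is invertible in the quotient ring, this ring is torsion: P makes its
  localisation at p finitely generated over the localised integers, and then
  \<open>divisible_span_torsion\<close> applies.\<close>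

lemma integer_in_ideal:
  fixes I :: "(int \<Rightarrow>\<^sub>0 int) set"
  assumes I: "ring_ideal I" "P \<in> I" and p: "Factorial_Ring.prime (p::int)"
    and lh: "l \<le> h" "Poly_Mapping.keys P \<subseteq> {l..h}"
      "\<not> p dvd Poly_Mapping.lookup P l" "\<not> p dvd Poly_Mapping.lookup P h"
    and one: "1 \<in> ideal_plus I (of_int p)"
  shows "\<exists>N. N \<noteq> 0 \<and> of_int N \<in> I"
proof -
  note zI = ring_ideal_zmodule[OF I(1)]
  let ?S = "int_span_mod I frag_of {l..<h}"
  have S: "zmodule ?S" by (rule int_span_mod_zmodule[OF zI])
  \<comment> \<open>After localisation at p, the elements of V are integral combinations of the finitely many
      monomials from l up to h - 1.\<close>
  define V where "V = {x. \<exists>q. \<not> p dvd q \<and> of_int q * x \<in> ?S}"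
  have V: "zmodule V"
    unfolding zmodule_def
  proof (intro conjI ballI)
    show "0 \<in> V" using p zmodule_zero[OF S] by (auto simp: V_def intro!: exI[of _ 1])
    fix x y assume "x \<in> V" "y \<in> V"
    then obtain q r where qr: "\<not> p dvd q" "of_int q * x \<in> ?S" "\<not> p dvd r" "of_int r * y \<in> ?S"
      by (auto simp: V_def)
    have "of_int (q * r) * (x - y) \<in> ?S"
      using zmodule_diff[OF S zmodule_of_int_mult[OF S qr(2), of r] zmodule_of_int_mult[OF S qr(4), of q]]
      by (simp add: algebra_simps)
    then show "x - y \<in> V" using qr p unfolding V_def by (auto simp: prime_dvd_mult_iff intro!: exI[of _ "q * r"])
  qed
  have SV: "?S \<subseteq> V" using p by (auto simp: V_def intro!: exI[of _ 1])
  have allV: "x \<in> V" for x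
  proof (rule laurent_reduction[OF I V _ lh(1,2)])
    show "I \<subseteq> V" using SV int_span_mod_base by blast
    show "frag_of i \<in> V" if "l \<le> i" "i < h" for i
      using int_span_mod_generator[OF zI, of "{l..<h}" i frag_of] that SV by auto
    have cancel: "x \<in> V" if "of_int c * x \<in> V" "\<not> p dvd c" for c x
    proof -
      from that(1) obtain q where "\<not> p dvd q" "of_int q * (of_int c * x) \<in> ?S"
        unfolding V_def mem_Collect_eq by (elim exE conjE)
      with that(2) p have "\<not> p dvd q * c" "of_int (q * c) * x \<in> ?S"
        by (simp_all add: prime_dvd_mult_iff mult.assoc)
      then show ?thesis unfolding V_def mem_Collect_eq by (intro exI conjI)
    qed
    show "of_int (Poly_Mapping.lookup P h) * x \<in> V \<Longrightarrow> x \<in> V"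
      "of_int (Poly_Mapping.lookup P l) * x \<in> V \<Longrightarrow> x \<in> V" for x
      using cancel lh(3,4) by blast+
  qed
  have "\<exists>q c. \<not> p dvd q \<and>
      of_int q * frag_of i - of_int p * (\<Sum>j\<in>{l..<h}. of_int (c j) * frag_of j) \<in> I" for i
  proof -
    obtain u r where ur: "1 = u + of_int p * r" "u \<in> I" using one unfolding ideal_plus_def by blast
    define x where "x = frag_of i * r"
    obtain q c where q: "\<not> p dvd q" "of_int q * x - (\<Sum>j\<in>{l..<h}. of_int (c j) * frag_of j) \<in> I"
      using allV[of x] by (auto simp: V_def int_span_mod_def)
    define y where "y = frag_of i * u + of_int p * x"
    have y: "frag_of i = y"
      using arg_cong[OF ur(1), of "\<lambda>z. frag_of i * z"] by (simp add: x_def y_def algebra_simps)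
    have "of_int q * y - of_int p * (\<Sum>j\<in>{l..<h}. of_int (c j) * frag_of j)
      = of_int q * (frag_of i * u) + of_int p * (of_int q * x - (\<Sum>j\<in>{l..<h}. of_int (c j) * frag_of j))"
      by (simp add: y_def algebra_simps)
    also have "\<dots> \<in> I"
      using q(2) ur(2) ring_ideal_mult[OF I(1)] by (intro zmodule_add zI) auto
    finally have "of_int q * frag_of i - of_int p * (\<Sum>j\<in>{l..<h}. of_int (c j) * frag_of j) \<in> I"
      unfolding y .
    with q(1) show ?thesis by (intro exI conjI)
  qed
  then obtain N where N: "\<not> p dvd N" "\<forall>i\<in>{l..<h}. of_int N * frag_of i \<in> I"
    using divisible_span_torsion[of "{l..<h}" I p frag_of] zI p by auto
  \<comment> \<open>The preimage of the torsion of the quotient ring.\<close>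
  define W where "W = {x. \<exists>m. m \<noteq> 0 \<and> of_int m * x \<in> I}"
  have W: "zmodule W"
    unfolding zmodule_def
  proof (intro conjI ballI)
    show "0 \<in> W" using zmodule_zero[OF zI] by (auto simp: W_def intro!: exI[of _ 1])
    fix x y assume "x \<in> W" "y \<in> W"
    then obtain q r where qr: "q \<noteq> 0" "of_int q * x \<in> I" "r \<noteq> 0" "of_int r * y \<in> I"
      by (auto simp: W_def)
    have "of_int (q * r) * (x - y) \<in> I"
      using zmodule_diff[OF zI zmodule_of_int_mult[OF zI qr(2), of r] zmodule_of_int_mult[OF zI qr(4), of q]]
      by (simp add: algebra_simps)
    then show "x - y \<in> W" using qr unfolding W_def by (auto intro!: exI[of _ "q * r"])
  qed
  have "1 \<in> W"
  proof (rule laurent_reduction[OF I W _ lh(1,2)])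
    show "I \<subseteq> W" by (auto simp: W_def intro!: exI[of _ 1])
    show "frag_of i \<in> W" if "l \<le> i" "i < h" for i
      using N that by (auto simp: W_def intro!: exI[of _ N])
    have cancel: "x \<in> W" if "of_int c * x \<in> W" "\<not> p dvd c" for c x
    proof -
      from that(1) obtain q where "q \<noteq> 0" "of_int q * (of_int c * x) \<in> I"
        unfolding W_def mem_Collect_eq by (elim exE conjE)
      with that(2) have "q * c \<noteq> 0" "of_int (q * c) * x \<in> I" by (auto simp: mult.assoc)
      then show ?thesis unfolding W_def mem_Collect_eq by (intro exI conjI)
    qed
    show "of_int (Poly_Mapping.lookup P h) * x \<in> W \<Longrightarrow> x \<in> W"
      "of_int (Poly_Mapping.lookup P l) * x \<in> W \<Longrightarrow> x \<in> W" for x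
      using cancel lh(3,4) by blast+
  qed
  then show ?thesis by (auto simp: W_def)
qed

text \<open>The number of residue classes modulo I + (n), say Q, is compared with the period of t on this
  finite quotient.  The integers that are congruent to 1 or -1 modulo each of the s primes
  give 2^s distinct square roots of 1 in the quotient.  Their products with powers of t collide
  before the exponent exceeds Q / 2^s, and a collision makes some t^d with 0 < d and d at most
  Q / 2^s equal to a square root of 1.  Then t^(2d) - 1 vanishes in the quotient, so Q is at most
  2 c d by the hypothesis, and comparison with the bound on d leaves 2^s at most 2 c.\<close>

lemma few_nonunit_primes:
  fixes I :: "(int \<Rightarrow>\<^sub>0 int) set"
  assumes I: "ring_ideal I"
    and bound: "\<And>k. k > 0 \<Longrightarrow> \<exists>Y. finite Y \<and> card Y \<le> c * k \<and>
                  (\<forall>x. \<exists>y\<in>Y. x - y \<in> ideal_plus I (frag_of (int k) - 1))"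
    and A: "finite A" "\<And>p. p \<in> A \<Longrightarrow> Factorial_Ring.prime p" "\<And>p::nat. p \<in> A \<Longrightarrow> p > 2"
      "\<And>p. p \<in> A \<Longrightarrow> 1 \<notin> ideal_plus I (of_nat p)"
    and n: "n = \<Prod>A" and fin: "finite (range (residue_class (ideal_plus I (of_nat n))))"
  shows "2 ^ card A \<le> 2 * c"
proof -
  let ?J = "ideal_plus I (of_nat n)"
  have J: "ring_ideal ?J" "zmodule ?J" using ideal_plus_ideal[OF I] ring_ideal_zmodule by auto
  have "\<exists>e. \<forall>p\<in>A. [e = (if p \<in> S then p - 1 else 1)] (mod p)" for S
    using A(1,2) by (intro chinese_remainder_nat) (auto intro: primes_coprime)
  then obtain e where e: "\<And>S p. p \<in> A \<Longrightarrow> [e S = (if p \<in> S then p - 1 else 1)] (mod p)" by metis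
  have e': "[int (e S) = (if p \<in> S then -1 else 1)] (mod (int p))" if "p \<in> A" for S p
  proof -
    have "[int (e S) = int (if p \<in> S then p - 1 else 1)] (mod (int p))"
      using e[OF that] by (simp add: cong_int_iff)
    moreover have "[int (p - 1) = -1] (mod (int p))"
      using A(3)[OF that] by (simp add: cong_iff_dvd_diff of_nat_diff)
    ultimately show ?thesis by (auto intro: cong_trans)
  qed
  have square: "of_nat (e S) * of_nat (e S) - 1 \<in> ?J" for S
  proof -
    have "[int (e S) * int (e S) = 1] (mod (int p))" if "p \<in> A" for p
      using cong_mult[OF e'[OF that] e'[OF that], of S S] by (simp split: if_splits)
    then have "[e S * e S = 1] (mod p)" if "p \<in> A" for p
      using that by (metis cong_int_iff of_nat_1 of_nat_mult)
    then have "[e S * e S = 1] (mod (\<Prod>p\<in>A. p))"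
      using A(2) by (intro coprime_cong_prod_nat) (auto intro: primes_coprime)
    then have "int n dvd int (e S * e S) - 1"
      unfolding n by (metis cong_iff_dvd_diff cong_int_iff of_nat_1)
    then obtain d where "int (e S * e S) - 1 = int n * d" by (rule dvdE)
    then have "(of_int (int (e S * e S) - 1) :: int \<Rightarrow>\<^sub>0 int) = of_int (int n * d)" by (simp only:)
    then have "of_nat (e S) * of_nat (e S) - 1 = of_nat n * (of_int d :: int \<Rightarrow>\<^sub>0 int)" by simp
    then show ?thesis using mult_in_ideal_plus[OF I] by metis
  qed
  \<comment> \<open>Modulo some p in A the difference of two of these integers is 2 or -2, and p is odd.\<close>
  have distinct: "of_nat (e S) - of_nat (e S') \<notin> ?J" if "S \<subseteq> A" "S' \<subseteq> A" "S \<noteq> S'" for S S'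
  proof
    assume *: "of_nat (e S) - of_nat (e S') \<in> ?J"
    have "\<exists>p\<in>A. p \<in> S \<longleftrightarrow> p \<notin> S'" using that by blast
    then obtain p where p: "p \<in> A" "p \<in> S \<longleftrightarrow> p \<notin> S'" by blast
    let ?K = "ideal_plus I (of_nat p)"
    have K: "ring_ideal ?K" "zmodule ?K" using ideal_plus_ideal[OF I] ring_ideal_zmodule by auto
    have "of_nat n = of_nat (\<Prod>(A - {p})) * (of_nat p :: int \<Rightarrow>\<^sub>0 int)"
      using A(1) p(1) by (simp add: n prod.remove mult.commute)
    moreover have pK: "of_nat p * x \<in> ?K" for x by (rule mult_in_ideal_plus[OF I])
    ultimately have "of_nat n \<in> ?K" by (metis mult.commute)
    then have "?J \<subseteq> ?K" by (intro ideal_plus_least K ideal_subset_ideal_plus)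
    with * have "of_int (int (e S) - int (e S')) * 1 \<in> ?K" by auto
    moreover have "\<not> int p dvd int (e S) - int (e S')"
    proof
      assume "int p dvd int (e S) - int (e S')"
      then have "[int (e S) = int (e S')] (mod (int p))" by (simp add: cong_iff_dvd_diff)
      then have "[(if p \<in> S then -1 else 1) = (if p \<in> S' then -1 else (1::int))] (mod (int p))"
        using e'[OF p(1)] by (metis cong_sym cong_trans)
      then have "int p dvd 2"
        using p(2) by (auto simp: cong_iff_dvd_diff split: if_splits)
      then show False using A(3)[OF p(1)] by (auto dest: zdvd_imp_le)
    qed
    moreover have "of_int (int p) * 1 \<in> ?K" using pK[of 1] by simp
    ultimately have "1 \<in> ?K"
      using cancel_prime_to[OF K(2), of "int p"] A(2)[OF p(1)] by auto
    then show False using A(4)[OF p(1)] by simp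
  qed
  have monomial: "frag_of m * x \<in> ?J" if "x \<in> ?J" for m x using ring_ideal_mult[OF J(1) that] .
  \<comment> \<open>The square of a = b t reads 1 = t^2 in the quotient if a and b are square roots of 1.\<close>
  have period: "frag_of (int (2 * (j - i))) - 1 \<in> ?J"
    if "i < j" "of_nat (e S) * frag_of (int i) - of_nat (e S') * frag_of (int j) \<in> ?J" for i j S S'
  proof -
    define a b t where "a = (of_nat (e S) :: int \<Rightarrow>\<^sub>0 int)" and "b = (of_nat (e S') :: int \<Rightarrow>\<^sub>0 int)"
      and "t = (frag_of (int (j - i)) :: int \<Rightarrow>\<^sub>0 int)"
    have "frag_of (- int i) * (a * frag_of (int i) - b * frag_of (int j))
       = a * (frag_of (- int i) * frag_of (int i)) - b * (frag_of (- int i) * frag_of (int j))"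
      by (simp only: right_diff_distrib mult.left_commute)
    also have "\<dots> = a - b * t" using that(1) by (simp add: frag_of_mult t_def of_nat_diff)
    finally have "a - b * t \<in> ?J" using monomial[OF that(2), of "- int i"] by (simp add: a_def b_def)
    then have "(- a - b * t) * (a - b * t) \<in> ?J" by (rule ring_ideal_mult[OF J(1)])
    moreover have "(t * t) * (b * b - 1) \<in> ?J" "a * a - 1 \<in> ?J"
      using square ring_ideal_mult[OF J(1)] by (auto simp: a_def b_def)
    ultimately have "(- a - b * t) * (a - b * t) - (t * t) * (b * b - 1) + (a * a - 1) \<in> ?J"
      using zmodule_add[OF J(2) zmodule_diff[OF J(2)]] by blast
    moreover have "(- a - b * t) * (a - b * t) - (t * t) * (b * b - 1) + (a * a - 1) = t * t - 1"
      by (simp add: algebra_simps)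
    moreover have "t * t = frag_of (int (2 * (j - i)))"
    proof -
      have "int (2 * (j - i)) = int (j - i) + int (j - i)" by simp
      then show ?thesis unfolding t_def frag_of_mult by (simp only:)
    qed
    ultimately show ?thesis by (simp only:)
  qed
  define Q where "Q = card (range (residue_class ?J))"
  define D where "D = Q div 2 ^ card A + 1"
  have "Q > 0" using fin by (auto simp: Q_def card_gt_0_iff)
  define f where "f = (\<lambda>(i, S). residue_class ?J (of_nat (e S) * frag_of (int i)))"
  have "card (f ` ({..<D} \<times> Pow A)) \<le> Q"
    unfolding Q_def f_def using fin by (intro card_mono) auto
  also have "Q < D * 2 ^ card A"
    unfolding D_def by (metis Suc_eq_plus1 dividend_less_times_div mult.commute mult_Suc_right
        zero_less_numeral zero_less_power)
  also have "\<dots> = card ({..<D} \<times> Pow A)" using A(1) by (simp add: card_Pow)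
  finally have "\<not> inj_on f ({..<D} \<times> Pow A)" using card_image by fastforce
  then obtain u v where uv: "u \<in> {..<D} \<times> Pow A" "v \<in> {..<D} \<times> Pow A" "u \<noteq> v" "f u = f v"
    unfolding inj_on_def by blast
  obtain i S j S' where "u = (i, S)" "v = (j, S')" by fastforce
  with uv have ij: "i < D" "j < D" "S \<subseteq> A" "S' \<subseteq> A" "(i, S) \<noteq> (j, S')"
    and diff: "of_nat (e S) * frag_of (int i) - of_nat (e S') * frag_of (int j) \<in> ?J"
    by (auto simp: f_def residue_class_eq_iff[OF J(2)])
  have "i \<noteq> j"
  proof
    assume "i = j"
    then have "S \<noteq> S'" using ij(5) by simp
    have "frag_of (- int i) * (of_nat (e S) * frag_of (int i) - of_nat (e S') * frag_of (int i))
       = of_nat (e S) * (frag_of (- int i) * frag_of (int i))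
         - of_nat (e S') * (frag_of (- int i) * frag_of (int i))"
      by (simp only: right_diff_distrib mult.left_commute)
    also have "\<dots> = of_nat (e S) - of_nat (e S')" by (simp add: frag_of_mult)
    finally show False
      using distinct[OF ij(3,4) \<open>S \<noteq> S'\<close>] monomial[OF diff, of "- int i"] \<open>i = j\<close> by simp
  qed
  \<comment> \<open>The two exponents differ, so the collision is a relation for a positive power of t.\<close>
  have "\<exists>d. 0 < d \<and> d < D \<and> frag_of (int (2 * d)) - 1 \<in> ?J"
  proof (cases "i < j")
    case True
    then show ?thesis using period[OF _ diff] ij(2) by (intro exI[of _ "j - i"]) auto
  next
    case False
    have "of_nat (e S') * frag_of (int j) - of_nat (e S) * frag_of (int i) \<in> ?J"
      using zmodule_minus[OF J(2) diff] by simp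
    then show ?thesis using period False \<open>i \<noteq> j\<close> ij(1) by (intro exI[of _ "i - j"]) auto
  qed
  then obtain d where d: "0 < d" "d < D" "frag_of (int (2 * d)) - 1 \<in> ?J" by blast
  obtain Y where Y: "finite Y" "card Y \<le> c * (2 * d)"
    "\<And>x. \<exists>y\<in>Y. x - y \<in> ideal_plus I (frag_of (int (2 * d)) - 1)"
    using bound[of "2 * d"] d(1) by auto
  have "ideal_plus I (frag_of (int (2 * d)) - 1) \<subseteq> ?J"
    using d(3) by (intro ideal_plus_least J ideal_subset_ideal_plus)
  then have "Q \<le> c * (2 * d)"
    unfolding Q_def using residue_classes_le_cover(2)[OF J(2) Y(1)] Y(2,3) by (meson order.trans subsetD)
  moreover have "d * 2 ^ card A \<le> Q"
    using d(2) unfolding D_def by (metis Suc_eq_plus1 div_times_less_eq_dividend less_Suc_eq_le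
        mult_le_mono1 order.trans)
  ultimately have "Q * 2 ^ card A \<le> 2 * c * Q"
  proof -
    have "Q * 2 ^ card A \<le> c * (2 * d) * 2 ^ card A" using \<open>Q \<le> c * (2 * d)\<close> by (rule mult_right_mono) simp
    also have "\<dots> = 2 * c * (d * 2 ^ card A)" by simp
    also have "\<dots> \<le> 2 * c * Q" using \<open>d * 2 ^ card A \<le> Q\<close> by (rule mult_left_mono) simp
    finally show ?thesis .
  qed
  then show ?thesis using \<open>Q > 0\<close> by (metis mult.commute mult_le_cancel1)
qed

text \<open>By \<open>few_nonunit_primes\<close> some prime that divides neither extreme coefficient of a primitive
  relation is invertible in the quotient.  Then I contains a nonzero integer N, and the residue
  classes modulo I are those modulo I + (N), which are finite in number.  Two examples show how
  the linear bound excludes infinite quotients: if I is zero, the quotients modulo t^k - 1 are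
  infinite, and if I is generated by t - 2, they have 2^k - 1 elements.\<close>

lemma laurent_quotient_finite:
  fixes I :: "(int \<Rightarrow>\<^sub>0 int) set"
  assumes I: "ring_ideal I"
    and bound: "\<And>k. k > 0 \<Longrightarrow> \<exists>Y. finite Y \<and> card Y \<le> c * k \<and>
                  (\<forall>x. \<exists>y\<in>Y. x - y \<in> ideal_plus I (frag_of (int k) - 1))"
  shows "finite (range (residue_class I))"
proof -
  \<comment> \<open>With this k the exponential 2^k exceeds the linear bound c k.\<close>
  define k where "k = 2 * (c + 1)"
  have "c * k < 2 ^ k"
  proof -
    have "c * k < 2 ^ (c + 1) * 2 ^ (c + 1)"
    proof (rule mult_less_le_imp_less)
      have "2 * (c + 1) \<le> 2 * 2 ^ c" using Suc_leI[OF less_exp[of c]] by (intro mult_le_mono2) simp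
      then show k: "k \<le> 2 ^ (c + 1)" by (simp add: k_def)
      have "c < k" by (simp add: k_def)
      with k show "c < 2 ^ (c + 1)" by (rule less_le_trans[rotated])
    qed (auto simp: k_def)
    also have "2 ^ (c + 1) * 2 ^ (c + 1) = (2 :: nat) ^ k"
      unfolding k_def mult_2 power_add by (rule refl)
    finally show ?thesis .
  qed
  moreover obtain Y where "finite Y" "card Y \<le> c * k"
    "\<And>x. \<exists>y\<in>Y. x - y \<in> ideal_plus I (frag_of (int k) - 1)"
    using bound[of k] by (auto simp: k_def)
  ultimately obtain P where P: "P \<in> I" "\<And>p. \<not> is_unit p \<Longrightarrow> \<exists>i. \<not> p dvd Poly_Mapping.lookup P i"
    using primitive_relation[OF I, of k Y] by (auto simp: k_def)
  have fin: "finite (range (residue_class (ideal_plus I (of_nat n))))" if "n > 0" for n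
  proof (rule finite_residues_mod_int[OF I _ that])
    fix p :: int assume p: "Factorial_Ring.prime p"
    then obtain i where "\<not> p dvd Poly_Mapping.lookup P i" using P(2)[of p] not_prime_unit by blast
    then show "finite (range (residue_class (ideal_plus I (of_int p))))"
      using finite_residues_mod_prime[OF I P(1) p] by blast
  qed
  let ?K = "Poly_Mapping.keys P"
  have "?K \<noteq> {}" using P(2)[of 2] by (auto simp: in_keys_iff)
  define l h where "l = Min ?K" and "h = Max ?K"
  have lh: "l \<in> ?K" "h \<in> ?K" "?K \<subseteq> {l..h}" "l \<le> h" using \<open>?K \<noteq> {}\<close> by (auto simp: l_def h_def)
  \<comment> \<open>Primes beyond this number are odd and divide neither of the extreme coefficients of P.\<close>
  let ?u = "nat \<bar>Poly_Mapping.lookup P l\<bar> + nat \<bar>Poly_Mapping.lookup P h\<bar> + 2"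
  have "infinite {p::nat. Factorial_Ring.prime p \<and> p > ?u}"
  proof
    assume "finite {p::nat. Factorial_Ring.prime p \<and> p > ?u}"
    then have "finite ({p::nat. Factorial_Ring.prime p \<and> p > ?u} \<union> {..?u})" by simp
    moreover have "{p::nat. Factorial_Ring.prime p} \<subseteq> {p. Factorial_Ring.prime p \<and> p > ?u} \<union> {..?u}" by auto
    ultimately show False using primes_infinite finite_subset by blast
  qed
  then obtain A where A: "finite A" "card A = 2 * c" "A \<subseteq> {p::nat. Factorial_Ring.prime p \<and> p > ?u}"
    using infinite_arbitrarily_large by blast
  have "\<exists>p\<in>A. 1 \<in> ideal_plus I (of_nat p)"
  proof (rule ccontr)
    assume "\<not> ?thesis"
    moreover have "\<Prod>A > 0" using A by (intro prod_pos) auto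
    ultimately have "2 ^ card A \<le> 2 * c"
      using A by (intro few_nonunit_primes[OF I bound _ _ _ _ refl fin]) auto
    then show False using A(2) less_exp[of "2 * c"] by simp
  qed
  then obtain p where p: "p \<in> A" "1 \<in> ideal_plus I (of_nat p)" by blast
  have nd: "\<not> int p dvd Poly_Mapping.lookup P i" if "i = l \<or> i = h" for i
  proof
    assume "int p dvd Poly_Mapping.lookup P i"
    moreover have "Poly_Mapping.lookup P i \<noteq> 0" using that lh by (auto simp: in_keys_iff)
    ultimately have "int p \<le> \<bar>Poly_Mapping.lookup P i\<bar>" using dvd_imp_le_int[of "Poly_Mapping.lookup P i" "int p"] by simp
    then show False using p(1) A(3) that by auto
  qed
  have "\<exists>N. N \<noteq> 0 \<and> of_int N \<in> I"
    by (rule integer_in_ideal[OF I P(1) _ lh(4,3), of "int p"]) (use p A(3) nd in auto)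
  then obtain N where N: "N \<noteq> 0" "of_int N \<in> I" by blast
  have "of_nat (nat \<bar>N\<bar>) \<in> I"
    using N(2) zmodule_minus[OF ring_ideal_zmodule[OF I] N(2)] by (cases "N \<ge> 0") (auto simp: of_nat_nat)
  then have "ideal_plus I (of_nat (nat \<bar>N\<bar>)) = I"
    using ideal_plus_least[OF I order_refl] ideal_subset_ideal_plus by blast
  then show ?thesis using fin[of "nat \<bar>N\<bar>"] N(1) by simp
qed

section \<open>Finite index and finite generation inside a fixed group\<close>

text \<open>Counting transversals instead of cosets keeps all subgroups inside one ambient group, and
  transitivity becomes a multiplication of transversals.\<close>

definition finite_index_in :: "('a, 'b) monoid_scheme \<Rightarrow> 'a set \<Rightarrow> 'a set \<Rightarrow> bool" where
  "finite_index_in G H K \<longleftrightarrow>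
     (\<exists>T. finite T \<and> T \<subseteq> K \<and> (\<forall>x\<in>K. \<exists>h\<in>H. \<exists>t\<in>T. x = h \<otimes>\<^bsub>G\<^esub> t))"

definition fg_subgroup :: "('a, 'b) monoid_scheme \<Rightarrow> 'a set \<Rightarrow> bool" where
  "fg_subgroup G K \<longleftrightarrow> (\<exists>S. finite S \<and> S \<subseteq> carrier G \<and> K = generate G S)"

context group
begin

lemma cancel_left:
  assumes "x \<in> carrier G" "y \<in> carrier G"
  shows "x \<otimes> (inv x \<otimes> y) = y" "inv x \<otimes> (x \<otimes> y) = y"
  using assms m_assoc[of x "inv x" y] m_assoc[of "inv x" x y] by simp_all

lemmas group_normalize = m_assoc cancel_left inv_mult_group

lemma fg_subgroup_subgroup: "fg_subgroup G K \<Longrightarrow> subgroup K G"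
  unfolding fg_subgroup_def using generate_is_subgroup by blast

lemma finite_index_in_refl:
  assumes "subgroup H G"
  shows "finite_index_in G H H"
  unfolding finite_index_in_def
  using subgroup.one_closed[OF assms] subgroup.mem_carrier[OF assms]
  by (intro exI[of _ "{\<one>}"]) auto

lemma finite_index_in_trans:
  assumes "finite_index_in G A B" "finite_index_in G B C" "A \<subseteq> carrier G" "B \<subseteq> C" "subgroup C G"
  shows "finite_index_in G A C"
proof -
  obtain S where S: "finite S" "S \<subseteq> B" "\<forall>x\<in>B. \<exists>a\<in>A. \<exists>s\<in>S. x = a \<otimes> s"
    using assms(1) unfolding finite_index_in_def by blast
  obtain T where T: "finite T" "T \<subseteq> C" "\<forall>x\<in>C. \<exists>b\<in>B. \<exists>t\<in>T. x = b \<otimes> t"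
    using assms(2) unfolding finite_index_in_def by blast
  have C: "C \<subseteq> carrier G" using assms(5) by (rule subgroup.subset)
  have "\<exists>a\<in>A. \<exists>u\<in>(\<lambda>(s, t). s \<otimes> t) ` (S \<times> T). x = a \<otimes> u" if x: "x \<in> C" for x
  proof -
    obtain b t where bt: "b \<in> B" "t \<in> T" "x = b \<otimes> t" using T(3) x by blast
    obtain a s where as: "a \<in> A" "s \<in> S" "b = a \<otimes> s" using S(3) bt(1) by blast
    have "a \<in> carrier G" "s \<in> carrier G" "t \<in> carrier G"
      using as bt assms(3,4) S(2) T(2) C by blast+
    then have "x = a \<otimes> (s \<otimes> t)" using as bt by (simp add: m_assoc)
    with as bt show ?thesis by blast
  qed
  moreover have "(\<lambda>(s, t). s \<otimes> t) ` (S \<times> T) \<subseteq> C"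
    using S(2) T(2) assms(4) by (auto intro!: subgroup.m_closed[OF assms(5)])
  ultimately show ?thesis
    unfolding finite_index_in_def using S(1) T(1)
    by (intro exI[of _ "(\<lambda>(s, t). s \<otimes> t) ` (S \<times> T)"]) auto
qed

lemma finite_index_in_mono:
  assumes "finite_index_in G A C" "A \<subseteq> B"
  shows "finite_index_in G B C"
  using assms unfolding finite_index_in_def by (meson subsetD)

lemma finite_index_in_finite:
  assumes "finite_index_in G H K" "finite H"
  shows "finite K"
proof -
  obtain T where T: "finite T" "\<forall>x\<in>K. \<exists>b\<in>H. \<exists>t\<in>T. x = b \<otimes> t"
    using assms(1) unfolding finite_index_in_def by blast
  then have "K \<subseteq> (\<lambda>(h, t). h \<otimes> t) ` (H \<times> T)" by fast
  then show ?thesis using T(1) assms(2) finite_subset by blast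
qed

text \<open>Schreier's lemma.  Rewriting t s = h t' with representatives t and t' produces the generators
  h of H.  The representative of the trivial coset may differ from 1, and therefore the
  representatives that lie in H are added to the generators.\<close>

lemma schreier:
  assumes K: "fg_subgroup G K" and H: "subgroup H G" "H \<subseteq> K" "finite_index_in G H K"
  shows "fg_subgroup G H"
proof -
  obtain S where S: "finite S" "S \<subseteq> carrier G" "K = generate G S"
    using K unfolding fg_subgroup_def by blast
  obtain T0 where T0: "finite T0" "T0 \<subseteq> K" "\<forall>x\<in>K. \<exists>h\<in>H. \<exists>t\<in>T0. x = h \<otimes> t"
    using H(3) unfolding finite_index_in_def by blast
  note subK = fg_subgroup_subgroup[OF K]
  define T where "T = insert \<one> T0"
  have T: "finite T" "T \<subseteq> K" "\<one> \<in> T" "\<forall>x\<in>K. \<exists>h\<in>H. \<exists>t\<in>T. x = h \<otimes> t"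
    using T0 subgroup.one_closed[OF subK] unfolding T_def by (simp, simp, simp, blast)
  have TG: "t \<in> carrier G" if "t \<in> T" for t using T(2) subgroup.mem_carrier[OF subK] that by blast
  define R where "R = S \<union> (\<lambda>s. inv s) ` S"
  have RK: "R \<subseteq> K" using S(3) generate.incl generate.inv by (fastforce simp: R_def)
  define Y where "Y = (T \<union> (\<lambda>(t, s, t'). t \<otimes> s \<otimes> inv t') ` (T \<times> R \<times> T)) \<inter> H"
  have Y: "finite Y" "Y \<subseteq> H" "Y \<subseteq> carrier G"
    using T(1) S(1) subgroup.subset[OF H(1)] by (auto simp: Y_def R_def)
  define U where "U = generate G Y"
  have U: "subgroup U G" "U \<subseteq> H" "Y \<subseteq> U"
    unfolding U_def using generate_is_subgroup[OF Y(3)] generate_subgroup_incl[OF Y(2) H(1)]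
    by (simp_all add: generate.incl subsetI)
  define Z where "Z = {u \<otimes> t | u t. u \<in> U \<and> t \<in> T}"
  have step: "z \<otimes> s \<in> Z" if zs: "z \<in> Z" "s \<in> R" for z s
  proof -
    obtain u t where ut: "u \<in> U" "t \<in> T" "z = u \<otimes> t" using zs(1) by (auto simp: Z_def)
    have G: "u \<in> carrier G" "t \<in> carrier G" "s \<in> carrier G"
      using ut TG zs(2) RK subgroup.subset[OF U(1)] subgroup.subset[OF subK] by blast+
    have "t \<otimes> s \<in> K" using ut(2) T(2) zs(2) RK by (intro subgroup.m_closed[OF subK]) auto
    then obtain h t' where h: "h \<in> H" "t' \<in> T" "t \<otimes> s = h \<otimes> t'" using T(4) by blast
    have G': "h \<in> carrier G" "t' \<in> carrier G" using h(1,2) TG subgroup.mem_carrier[OF H(1)] by blast+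
    have "t \<otimes> s \<otimes> inv t' = h" using h(3) G G' by (simp add: m_assoc)
    then have "h \<in> (\<lambda>(t, s, t'). t \<otimes> s \<otimes> inv t') ` (T \<times> R \<times> T)"
      using ut(2) zs(2) h(2) by force
    then have "h \<in> U" using h(1) U(3) unfolding Y_def by blast
    then have "u \<otimes> h \<in> U" using ut(1) by (intro subgroup.m_closed[OF U(1)])
    moreover have "z \<otimes> s = (u \<otimes> h) \<otimes> t'" using ut(3) h(3) G G' by (simp add: m_assoc)
    ultimately show ?thesis using h(2) unfolding Z_def by blast
  qed
  have ZG: "z \<in> carrier G" if "z \<in> Z" for z
    using that TG subgroup.mem_carrier[OF U(1)] by (auto simp: Z_def)
  have "z \<otimes> x \<in> Z" if "x \<in> generate G S" "z \<in> Z" for x z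
    using that
  proof (induction x arbitrary: z rule: generate.induct)
    case one
    then show ?case using ZG by simp
  next
    case (incl h)
    then show ?case using step by (auto simp: R_def)
  next
    case (inv h)
    then show ?case using step by (auto simp: R_def)
  next
    case (eng h1 h2)
    have "h1 \<in> carrier G" "h2 \<in> carrier G" using eng.hyps generate_in_carrier[OF S(2)] by auto
    then show ?case using eng.IH(2)[OF eng.IH(1)[OF eng.prems]] ZG[OF eng.prems] by (simp add: m_assoc)
  qed
  moreover have "\<one> \<in> Z"
    using T(3) subgroup.one_closed[OF U(1)] unfolding Z_def by force
  ultimately have KZ: "x \<in> Z" if "x \<in> K" for x
    using that S(3) subgroup.mem_carrier[OF subK that] by fastforce
  have "H \<subseteq> U"
  proof
    fix x assume x: "x \<in> H"
    have "x \<in> Z" using KZ x H(2) by blast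
    then obtain u t where ut: "u \<in> U" "t \<in> T" "x = u \<otimes> t" by (auto simp: Z_def)
    have "t = inv u \<otimes> x"
      using ut TG subgroup.mem_carrier[OF U(1)] by (simp add: cancel_left)
    then have "t \<in> H"
      using x ut(1) U(2) by (auto intro!: subgroup.m_closed[OF H(1)] subgroup.m_inv_closed[OF H(1)])
    then have "t \<in> U" using ut(2) U(3) unfolding Y_def by blast
    then show "x \<in> U" using ut by (auto intro: subgroup.m_closed[OF U(1)])
  qed
  then have "H = generate G Y" using U(2) by (auto simp: U_def)
  then show ?thesis unfolding fg_subgroup_def using Y(1,3) by blast
qed

end

section \<open>Extensions by an infinite cyclic group\<close>

text \<open>Stability under conjugation by t alone would allow t to conjugate M onto a proper subgroup.\<close>

locale stable_subgroup = group G for G (structure) +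
  fixes M t
  assumes subgroup_M: "subgroup M G"
    and t_closed [simp]: "t \<in> carrier G"
    and conj_t: "m \<in> M \<Longrightarrow> t \<otimes> m \<otimes> inv t \<in> M"
    and conj_inv_t: "m \<in> M \<Longrightarrow> inv t \<otimes> m \<otimes> t \<in> M"

locale cyclic_extension = stable_subgroup +
  assumes pow_t_in_M: "t [^] (i::int) \<in> M \<Longrightarrow> i = 0"

definition cyclic_product :: "('a, 'b) monoid_scheme \<Rightarrow> 'a set \<Rightarrow> 'a \<Rightarrow> 'a set" where
  "cyclic_product G M t = {m \<otimes>\<^bsub>G\<^esub> t [^]\<^bsub>G\<^esub> i | m (i::int). m \<in> M}"

text \<open>The point is that c is independent of k.  For an abelian quotient A of M on
  which t acts, this makes the order of A/(t^k - 1)A grow at most linearly in k.\<close>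

definition bounded_classes :: "('a, 'b) monoid_scheme \<Rightarrow> 'a set \<Rightarrow> 'a \<Rightarrow> nat \<Rightarrow> bool" where
  "bounded_classes G M t c \<longleftrightarrow> (\<forall>k::nat. k > 0 \<longrightarrow>
     (\<exists>E. finite E \<and> card E \<le> c \<and> E \<subseteq> M \<and> (\<forall>m\<in>M. \<exists>e\<in>E. \<exists>x\<in>cyclic_product G M t.
        m \<otimes>\<^bsub>G\<^esub> t [^]\<^bsub>G\<^esub> int k = x \<otimes>\<^bsub>G\<^esub> (e \<otimes>\<^bsub>G\<^esub> t [^]\<^bsub>G\<^esub> int k) \<otimes>\<^bsub>G\<^esub> inv\<^bsub>G\<^esub> x)))"

context stable_subgroup
begin

lemma M_carrier: "m \<in> M \<Longrightarrow> m \<in> carrier G"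
  using subgroup.mem_carrier[OF subgroup_M] .

lemma pow_closed [simp]: "t [^] (i::int) \<in> carrier G"
  by simp

lemma conj_pow: "m \<in> M \<Longrightarrow> t [^] (i::int) \<otimes> m \<otimes> inv (t [^] i) \<in> M"
proof (induction i rule: int_induct[where k = 0])
  case base
  then show ?case using M_carrier by simp
next
  case (step1 i)
  have "t [^] (i + 1) \<otimes> m \<otimes> inv (t [^] (i + 1)) = t \<otimes> (t [^] i \<otimes> m \<otimes> inv (t [^] i)) \<otimes> inv t"
    using step1.prems M_carrier by (simp add: add.commute[of i] int_pow_mult group_normalize)
  then show ?case using conj_t step1 by simp
next
  case (step2 i)
  have "t [^] (i - 1) = inv t \<otimes> t [^] i"
    using int_pow_mult[of t "-1" i] by (simp add: int_pow_neg)
  then have "t [^] (i - 1) \<otimes> m \<otimes> inv (t [^] (i - 1)) = inv t \<otimes> (t [^] i \<otimes> m \<otimes> inv (t [^] i)) \<otimes> t"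
    using step2.prems M_carrier by (simp add: group_normalize)
  then show ?case using conj_inv_t step2 by simp
qed

lemma conj_inv_pow: "m \<in> M \<Longrightarrow> inv (t [^] (i::int)) \<otimes> m \<otimes> t [^] i \<in> M"
  using conj_pow[of m "- i"] by (simp add: int_pow_neg)

lemma cyclic_product_I: "m \<in> M \<Longrightarrow> m \<otimes> t [^] (i::int) \<in> cyclic_product G M t"
  unfolding cyclic_product_def by blast

lemma M_subset_product: "M \<subseteq> cyclic_product G M t"
  using cyclic_product_I[of _ 0] M_carrier by fastforce

lemma pow_in_product: "t [^] (i::int) \<in> cyclic_product G M t"
  using cyclic_product_I[OF subgroup.one_closed[OF subgroup_M], of i] by simp

lemma t_in_product: "t \<in> cyclic_product G M t"
  using pow_in_product[of 1] by simp

lemma product_subgroup: "subgroup (cyclic_product G M t) G"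
proof (rule subgroupI)
  show "cyclic_product G M t \<subseteq> carrier G" using M_carrier by (auto simp: cyclic_product_def)
  show "cyclic_product G M t \<noteq> {}" using t_in_product by blast
next
  fix x assume "x \<in> cyclic_product G M t"
  then obtain m and i :: int where x: "x = m \<otimes> t [^] i" "m \<in> M" by (auto simp: cyclic_product_def)
  then have "inv x = (inv (t [^] i) \<otimes> inv m \<otimes> t [^] i) \<otimes> t [^] (- i)"
    using M_carrier by (simp add: group_normalize int_pow_neg)
  then show "inv x \<in> cyclic_product G M t"
    using conj_inv_pow x(2) subgroup.m_inv_closed[OF subgroup_M] cyclic_product_I by metis
next
  fix x y assume "x \<in> cyclic_product G M t" "y \<in> cyclic_product G M t"
  then obtain m n and i j :: int where x: "x = m \<otimes> t [^] i" "m \<in> M" "y = n \<otimes> t [^] j" "n \<in> M"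
    by (auto simp: cyclic_product_def)
  then have "x \<otimes> y = (m \<otimes> (t [^] i \<otimes> n \<otimes> inv (t [^] i))) \<otimes> t [^] (i + j)"
    using M_carrier by (simp add: group_normalize int_pow_mult)
  then show "x \<otimes> y \<in> cyclic_product G M t"
    using conj_pow x subgroup.m_closed[OF subgroup_M] cyclic_product_I by metis
qed

lemma product_carrier: "x \<in> cyclic_product G M t \<Longrightarrow> x \<in> carrier G"
  using subgroup.mem_carrier[OF product_subgroup] .

lemma product_minimal:
  assumes "subgroup H G" "M \<subseteq> H" "t \<in> H"
  shows "cyclic_product G M t \<subseteq> H"
  using assms subgroup_int_pow_closed[OF assms(1,3)] subgroup.m_closed[OF assms(1)]
  by (auto simp: cyclic_product_def)

text \<open>The coset M t^k is stable under conjugation because the quotient of the product by M is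
  cyclic, hence abelian.\<close>

lemma conj_layer:
  assumes "y \<in> cyclic_product G M t" "m \<in> M"
  shows "\<exists>n\<in>M. y \<otimes> (m \<otimes> t [^] (k::int)) \<otimes> inv y = n \<otimes> t [^] k"
proof -
  obtain a and i :: int where a: "y = a \<otimes> t [^] i" "a \<in> M" using assms(1) by (auto simp: cyclic_product_def)
  have comm: "t [^] i \<otimes> (t [^] k \<otimes> z) = t [^] k \<otimes> (t [^] i \<otimes> z)" if "z \<in> carrier G" for z
    using that by (simp add: add.commute flip: m_assoc int_pow_mult)
  let ?n = "a \<otimes> (t [^] i \<otimes> m \<otimes> inv (t [^] i)) \<otimes> (t [^] k \<otimes> inv a \<otimes> inv (t [^] k))"
  have "?n \<otimes> t [^] k = a \<otimes> (t [^] i \<otimes> (m \<otimes> (inv (t [^] i) \<otimes> (t [^] k \<otimes> inv a))))"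
    using a(2) assms(2) M_carrier by (simp add: group_normalize)
  also have "inv (t [^] i) \<otimes> (t [^] k \<otimes> inv a) = t [^] k \<otimes> (inv (t [^] i) \<otimes> inv a)"
    using comm[of "inv (t [^] i) \<otimes> inv a"] a(2) M_carrier
    by (metis cancel_left inv_closed m_closed pow_closed)
  finally have "y \<otimes> (m \<otimes> t [^] k) \<otimes> inv y = ?n \<otimes> t [^] k"
    using a assms(2) M_carrier by (simp add: group_normalize)
  moreover have "?n \<in> M"
    using a(2) assms(2) by (intro subgroup.m_closed[OF subgroup_M] conj_pow subgroup.m_inv_closed[OF subgroup_M])
  ultimately show ?thesis by blast
qed

end

context cyclic_extension
begin

lemma finite_index_in_product:
  assumes B: "subgroup B G" "B \<subseteq> M" "finite_index_in G B M"
    and ext: "cyclic_extension G B t"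
  obtains T where "finite T" "T \<subseteq> M" 
    "\<forall>x\<in>cyclic_product G M t. \<exists>y\<in>cyclic_product G B t. \<exists>s\<in>T. x = y \<otimes> s"
proof -
  interpret B: cyclic_extension G B t by (rule ext)
  obtain T where T: "finite T" "T \<subseteq> M" "\<forall>x\<in>M. \<exists>b\<in>B. \<exists>s\<in>T. x = b \<otimes> s"
    using B(3) unfolding finite_index_in_def by blast
  have "\<exists>y\<in>cyclic_product G B t. \<exists>s\<in>T. x = y \<otimes> s" if x: "x \<in> cyclic_product G M t" for x
  proof -
    obtain m and i :: int where m: "x = m \<otimes> t [^] i" "m \<in> M" using x by (auto simp: cyclic_product_def)
    obtain b s where bs: "b \<in> B" "s \<in> T" "inv (t [^] i) \<otimes> m \<otimes> t [^] i = b \<otimes> s"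
      using T(3) conj_inv_pow[OF m(2), of i] by blast
    have "x = t [^] i \<otimes> (inv (t [^] i) \<otimes> m \<otimes> t [^] i)"
      using m M_carrier by (simp add: group_normalize)
    also have "\<dots> = (t [^] i \<otimes> b) \<otimes> s"
      using bs T(2) M_carrier B.M_carrier by (auto simp: m_assoc)
    finally show ?thesis
      using bs(1,2) subgroup.m_closed[OF B.product_subgroup B.pow_in_product subsetD[OF B.M_subset_product bs(1)]]
      by (intro bexI)
  qed
  with T(1,2) that show thesis by blast
qed

text \<open>If x = y s with y in the smaller product and s in a transversal, then conjugation by x factors
  through conjugation of e t^k by s.  So every old class splits into at most as many new
  classes as there are representatives s.\<close>

lemma bounded_classes_finite_index:
  assumes B: "subgroup B G" "B \<subseteq> M" "finite_index_in G B M"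
    and ext: "cyclic_extension G B t" and c: "bounded_classes G M t c"
  shows "\<exists>c'. bounded_classes G B t c'"
proof -
  interpret B: cyclic_extension G B t by (rule ext)
  obtain T where T: "finite T" "T \<subseteq> M"
    "\<forall>x\<in>cyclic_product G M t. \<exists>y\<in>cyclic_product G B t. \<exists>s\<in>T. x = y \<otimes> s"
    using finite_index_in_product[OF B ext] by blast
  have "bounded_classes G B t (card T * c)"
    unfolding bounded_classes_def
  proof (intro allI impI)
    fix k :: nat assume "k > 0"
    let ?t = "t [^] int k"
    obtain E where E: "finite E" "card E \<le> c" "E \<subseteq> M"
      "\<And>m. m \<in> M \<Longrightarrow> \<exists>e\<in>E. \<exists>x\<in>cyclic_product G M t. m \<otimes> ?t = x \<otimes> (e \<otimes> ?t) \<otimes> inv x"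
      using c \<open>k > 0\<close> unfolding bounded_classes_def by meson
    define F where "F = (\<lambda>(s, e). s \<otimes> (e \<otimes> ?t) \<otimes> inv s \<otimes> inv ?t) ` (T \<times> E)"
    have "\<exists>f\<in>F \<inter> B. \<exists>y\<in>cyclic_product G B t. b \<otimes> ?t = y \<otimes> (f \<otimes> ?t) \<otimes> inv y" if b: "b \<in> B" for b
    proof -
      obtain e x where ex: "e \<in> E" "x \<in> cyclic_product G M t" "b \<otimes> ?t = x \<otimes> (e \<otimes> ?t) \<otimes> inv x"
        using E(4)[of b] b B(2) by blast
      obtain y s where ys: "y \<in> cyclic_product G B t" "s \<in> T" "x = y \<otimes> s" using T(3) ex(2) by blast
      have G: "e \<in> carrier G" "y \<in> carrier G" "s \<in> carrier G" "b \<in> carrier G"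
        using ex(1) ys b E(3) T(2) M_carrier B.M_carrier B.product_carrier by blast+
      let ?f = "s \<otimes> (e \<otimes> ?t) \<otimes> inv s \<otimes> inv ?t"
      have f: "?f \<otimes> ?t = inv y \<otimes> (b \<otimes> ?t) \<otimes> inv (inv y)"
        using G unfolding ex(3) ys(3) by (simp add: group_normalize)
      obtain n where n: "n \<in> B" "inv y \<otimes> (b \<otimes> ?t) \<otimes> inv (inv y) = n \<otimes> ?t"
        using B.conj_layer[OF subgroup.m_inv_closed[OF B.product_subgroup ys(1)] b] by blast
      have "?f = n"
        using f n(1) G B.M_carrier unfolding n(2) by (subst (asm) r_cancel) auto
      with n(1) have "?f \<in> B" by simp
      moreover have "b \<otimes> ?t = y \<otimes> (?f \<otimes> ?t) \<otimes> inv y"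
        unfolding f using G by (simp add: group_normalize)
      moreover have "?f \<in> F" unfolding F_def using ys(2) ex(1) by force
      ultimately show ?thesis using ys(1) by blast
    qed
    moreover have "finite (F \<inter> B)" using T(1) E(1) by (auto simp: F_def)
    moreover have "card (F \<inter> B) \<le> card T * c"
    proof -
      have "card (F \<inter> B) \<le> card (T \<times> E)"
        unfolding F_def using T(1) E(1)
        by (meson card_image_le card_mono finite_SigmaI finite_imageI inf_le1 order.trans)
      then show ?thesis using E(2) by (simp add: card_cartesian_product) (meson le_trans mult_le_mono2)
    qed
    ultimately show "\<exists>E. finite E \<and> card E \<le> card T * c \<and> E \<subseteq> B \<and> (\<forall>m\<in>B. \<exists>e\<in>E. \<exists>x\<in>cyclic_product G B t.
        m \<otimes> ?t = x \<otimes> (e \<otimes> ?t) \<otimes> inv x)"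
      by (intro exI[of _ "F \<inter> B"]) auto
  qed
  then show ?thesis by blast
qed

end

section \<open>Abelian quotients as modules over Laurent polynomials\<close>

lemma frag_of_multiple_minus_one:
  fixes K :: "(int \<Rightarrow>\<^sub>0 int) set"
  assumes K: "ring_ideal K" "frag_of k - 1 \<in> K"
  shows "frag_of (k * q) - 1 \<in> K"
proof (induction q rule: int_induct[where k = 0])
  case base
  then show ?case using zmodule_zero[OF ring_ideal_zmodule[OF K(1)]] by simp
next
  case (step1 q)
  have e: "frag_of (k * (q + 1)) - 1 = frag_of k * (frag_of (k * q) - 1) + (frag_of k - (1 :: int \<Rightarrow>\<^sub>0 int))"
    by (simp add: algebra_simps frag_of_mult)
  then show ?case
    using zmodule_add[OF ring_ideal_zmodule[OF K(1)] ring_ideal_mult[OF K(1) step1.IH] K(2)]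
    by (simp only: e)
next
  case (step2 q)
  have e: "frag_of (k * (q - 1)) - 1
     = frag_of (- k) * (frag_of (k * q) - 1) - frag_of (- k) * (frag_of k - (1 :: int \<Rightarrow>\<^sub>0 int))"
    by (simp add: algebra_simps frag_of_mult)
  then show ?case
    using zmodule_diff[OF ring_ideal_zmodule[OF K(1)] ring_ideal_mult[OF K(1) step2.IH] ring_ideal_mult[OF K]]
    by (simp only: e)
qed

context group
begin

lemma generate_conj_closed:
  assumes g: "g \<in> carrier G" and S: "S \<subseteq> carrier G" and H: "subgroup H G"
    and conj: "\<And>s. s \<in> S \<Longrightarrow> g \<otimes> s \<otimes> inv g \<in> H"
    and x: "x \<in> generate G S"
  shows "g \<otimes> x \<otimes> inv g \<in> H"
  using x
proof (induction x rule: generate.induct)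
  case one
  then show ?case using g subgroup.one_closed[OF H] by simp
next
  case (incl h)
  then show ?case by (rule conj)
next
  case (inv h)
  have "g \<otimes> inv h \<otimes> inv g = inv (g \<otimes> h \<otimes> inv g)"
    using g S inv by (auto simp: group_normalize)
  then show ?case using conj[OF inv] subgroup.m_inv_closed[OF H] by simp
next
  case (eng h1 h2)
  have "h1 \<in> carrier G" "h2 \<in> carrier G" using eng.hyps generate_in_carrier[OF S] by auto
  then have "g \<otimes> (h1 \<otimes> h2) \<otimes> inv g = (g \<otimes> h1 \<otimes> inv g) \<otimes> (g \<otimes> h2 \<otimes> inv g)"
    using g by (simp add: group_normalize)
  then show ?case using eng.IH subgroup.m_closed[OF H] by simp
qed

lemma commutator_in_derived:
  assumes "x \<in> M" "y \<in> M"
  shows "x \<otimes> y \<otimes> inv x \<otimes> inv y \<in> derived G M"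
  unfolding derived_def using assms by (intro generate.incl) blast

lemma conj_in_of_derived_subset:
  assumes "subgroup M G" "subgroup C G" "C \<subseteq> M" "derived G M \<subseteq> C" "x \<in> M" "y \<in> C"
  shows "x \<otimes> y \<otimes> inv x \<in> C"
proof -
  have G: "x \<in> carrier G" "y \<in> carrier G"
    using assms(5,6) subgroup.subset[OF assms(1)] subgroup.subset[OF assms(2)] by auto
  have "x \<otimes> y \<otimes> inv x \<otimes> inv y \<in> C"
    using commutator_in_derived[of x M y] assms(3-6) by blast
  then have "(x \<otimes> y \<otimes> inv x \<otimes> inv y) \<otimes> y \<in> C"
    using assms(6) by (rule subgroup.m_closed[OF assms(2)])
  then show ?thesis using G by (simp add: group_normalize)
qed

text \<open>The converse of \<open>derived_of_subgroup_minimal\<close>, in the form in which it produces the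
  commutative group that carries the module structure.\<close>

lemma derived_subset_imp_comm_quotient:
  assumes M: "subgroup M G" and C: "subgroup C G" "C \<subseteq> M" "derived G M \<subseteq> C"
  shows "C \<lhd> (G\<lparr>carrier := M\<rparr>)" "comm_group (G\<lparr>carrier := M\<rparr> Mod C)"
proof -
  let ?N = "G\<lparr>carrier := M\<rparr>"
  interpret N: group ?N by (rule subgroup_imp_group[OF M])
  show nC: "C \<lhd> ?N"
  proof (rule N.normal_invI)
    show "subgroup C ?N" using subgroup_incl[OF C(1) M C(2)] .
    show "x \<otimes>\<^bsub>?N\<^esub> h \<otimes>\<^bsub>?N\<^esub> inv\<^bsub>?N\<^esub> x \<in> C" if "h \<in> C" "x \<in> carrier ?N" for x h
      using conj_in_of_derived_subset[OF M C] that m_inv_consistent[OF M] by simp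
  qed
  interpret C: normal C ?N by (rule nC)
  show "comm_group (?N Mod C)"
  proof (rule group.group_comm_groupI[OF C.factorgroup_is_group])
    fix U V assume "U \<in> carrier (?N Mod C)" "V \<in> carrier (?N Mod C)"
    then obtain x y where xy: "x \<in> M" "y \<in> M" "U = C #>\<^bsub>?N\<^esub> x" "V = C #>\<^bsub>?N\<^esub> y"
      unfolding FactGroup_def RCOSETS_def by auto
    have G: "x \<in> carrier G" "y \<in> carrier G" using xy(1,2) subgroup.subset[OF M] by auto
    have "x \<otimes> y \<otimes> inv x \<otimes> inv y \<in> C" using commutator_in_derived[OF xy(1,2)] C(3) by blast
    moreover have "x \<otimes> y = (x \<otimes> y \<otimes> inv x \<otimes> inv y) \<otimes> (y \<otimes> x)"
      using G by (simp add: group_normalize)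
    ultimately have "x \<otimes>\<^bsub>?N\<^esub> y \<in> C #>\<^bsub>?N\<^esub> (y \<otimes>\<^bsub>?N\<^esub> x)"
      unfolding r_coset_def by auto
    then have "C #>\<^bsub>?N\<^esub> (y \<otimes>\<^bsub>?N\<^esub> x) = C #>\<^bsub>?N\<^esub> (x \<otimes>\<^bsub>?N\<^esub> y)"
      using xy(1,2) subgroup.m_closed[OF M] C.subgroup_axioms
      by (intro N.repr_independence) auto
    then show "U \<otimes>\<^bsub>?N Mod C\<^esub> V = V \<otimes>\<^bsub>?N Mod C\<^esub> U"
      using xy C.rcos_sum by (simp add: FactGroup_def)
  qed
qed

end

context cyclic_extension
begin

lemma conj_derived_closed:
  assumes "x \<in> derived G M"
  shows "t [^] (i::int) \<otimes> x \<otimes> inv (t [^] i) \<in> derived G M"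
proof -
  note MG = subgroup.subset[OF subgroup_M]
  show ?thesis
  proof (rule generate_conj_closed[OF pow_closed derived_set_in_carrier[OF MG] derived_is_subgroup[OF MG]])
    show "x \<in> generate G (derived_set G M)" using assms by (simp add: derived_def)
    fix s assume "s \<in> derived_set G M"
    then obtain m n where mn: "m \<in> M" "n \<in> M" "s = m \<otimes> n \<otimes> inv m \<otimes> inv n" by blast
    let ?c = "\<lambda>m. t [^] i \<otimes> m \<otimes> inv (t [^] i)"
    have "?c s = ?c m \<otimes> ?c n \<otimes> inv (?c m) \<otimes> inv (?c n)"
      using mn M_carrier by (simp add: group_normalize)
    then show "?c s \<in> derived G M"
      using commutator_in_derived[OF conj_pow[OF mn(1)] conj_pow[OF mn(2)]] by simp
  qed
qed

text \<open>The quotient of M by C is abelian and is generated by the conjugates of a under the powers of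
  t, so it is a homomorphic image of the additive group of Laurent polynomials.  The relation
  p f m says that f is mapped to the coset of m; it avoids further computation with cosets.  The
  last clause turns multiplication by a monomial into conjugation by a power of t.\<close>

lemma laurent_presentation:
  assumes C: "subgroup C G" "C \<subseteq> M" "derived G M \<subseteq> C"
    and conj_C: "\<And>c i. c \<in> C \<Longrightarrow> t [^] (i::int) \<otimes> c \<otimes> inv (t [^] i) \<in> C"
    and a: "a \<in> M"
    and gen: "M = generate G (C \<union> range (\<lambda>i::int. t [^] i \<otimes> a \<otimes> inv (t [^] i)))"
  shows "\<exists>p :: (int \<Rightarrow>\<^sub>0 int) \<Rightarrow> 'a \<Rightarrow> bool. 
    (\<forall>f m. p f m \<longrightarrow> m \<in> M) \<and> (\<forall>f. \<exists>m. p f m) \<and> (\<forall>m\<in>M. \<exists>f. p f m) \<and>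
    (\<forall>m. p 0 m \<longleftrightarrow> m \<in> C) \<and>
    (\<forall>f g m n. p f m \<longrightarrow> p g n \<longrightarrow> p (f - g) (m \<otimes> inv n)) \<and>
    (\<forall>f m j. p f m \<longrightarrow> p (frag_of j * f) (t [^] j \<otimes> m \<otimes> inv (t [^] j)))"
proof -
  let ?N = "G\<lparr>carrier := M\<rparr>"
  let ?Q = "?N Mod C"
  note Q = derived_subset_imp_comm_quotient[OF subgroup_M C]
  interpret N: group ?N by (rule subgroup_imp_group[OF subgroup_M])
  interpret C: normal C ?N by (rule Q(1))
  interpret Q: comm_group ?Q by (rule Q(2))
  have CG: "c \<in> carrier G" if "c \<in> C" for c using that C(2) M_carrier by blast
  have carQ: "U \<in> carrier ?Q \<longleftrightarrow> (\<exists>m\<in>M. U = C #> m)" for U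
    unfolding FactGroup_def RCOSETS_def r_coset_def by auto
  have multQ: "(C #> m) \<otimes>\<^bsub>?Q\<^esub> (C #> n) = C #> (m \<otimes> n)" if "m \<in> M" "n \<in> M" for m n
    using C.rcos_sum[of m n] that by (simp add: FactGroup_def r_coset_def)
  have oneQ: "\<one>\<^bsub>?Q\<^esub> = C" by (simp add: FactGroup_def)
  have coset_eq: "C #> m = C #> n \<longleftrightarrow> m \<otimes> inv n \<in> C" if "m \<in> M" "n \<in> M" for m n
  proof -
    have G: "m \<in> carrier G" "n \<in> carrier G" using that M_carrier by auto
    show ?thesis
    proof
      assume "C #> m = C #> n"
      then have "m \<in> C #> n" using rcos_self[OF G(1) C(1)] by simp
      then obtain c where "c \<in> C" "m = c \<otimes> n" unfolding r_coset_def by blast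
      then show "m \<otimes> inv n \<in> C" using G CG by (simp add: m_assoc)
    next
      assume *: "m \<otimes> inv n \<in> C"
      have "m = (m \<otimes> inv n) \<otimes> n" using G by (simp add: m_assoc)
      then have "m \<in> C #> n" using * unfolding r_coset_def by blast
      then show "C #> m = C #> n" using repr_independence[OF _ G(2) C(1)] by simp
    qed
  qed
  have invQ: "inv\<^bsub>?Q\<^esub> (C #> m) = C #> inv m" if "m \<in> M" for m
  proof (rule Q.inv_equality)
    have "inv m \<in> M" using subgroup.m_inv_closed[OF subgroup_M that] .
    from multQ[OF this that] show "(C #> inv m) \<otimes>\<^bsub>?Q\<^esub> (C #> m) = \<one>\<^bsub>?Q\<^esub>"
      using M_carrier[OF that] coset_mult_one[OF subgroup.subset[OF C(1)]] by (simp only: oneQ l_inv)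
    show "C #> inv m \<in> carrier ?Q" "C #> m \<in> carrier ?Q"
      using that \<open>inv m \<in> M\<close> unfolding carQ by blast+
  qed
  define b where "b i = t [^] (i::int) \<otimes> a \<otimes> inv (t [^] i)" for i
  have b: "b i \<in> M" for i using conj_pow[OF a] by (simp add: b_def)
  have "C #> b i \<in> carrier ?Q" for i using b[of i] unfolding carQ by blast
  then have "(\<lambda>i. C #> b i) ` UNIV \<subseteq> carrier ?Q" by (rule image_subsetI)
  then obtain h where h: "h \<in> hom (free_Abelian_group (UNIV :: int set)) ?Q" "\<And>i. h (frag_of i) = C #> b i"
    using Q.free_Abelian_group_universal[of "\<lambda>i. C #> b i" UNIV] by (metis UNIV_I)
  interpret h: group_hom "free_Abelian_group (UNIV :: int set)" ?Q h
    using h(1) by (simp add: group_hom_def group_hom_axioms_def Q.is_group)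
  have h_diff: "h (f - g) = h f \<otimes>\<^bsub>?Q\<^esub> inv\<^bsub>?Q\<^esub> h g" for f g
    using h.hom_mult[of f "- g"] h.hom_inv[of g] by simp
  define p where "p f m \<longleftrightarrow> m \<in> M \<and> h f = C #> m" for f m
  have p_diff: "p (f - g) (m \<otimes> inv n)" if "p f m" "p g n" for f g m n
  proof -
    have M: "m \<in> M" "inv n \<in> M" "n \<in> M"
      using that subgroup.m_inv_closed[OF subgroup_M] by (auto simp: p_def)
    have "h (f - g) = (C #> m) \<otimes>\<^bsub>?Q\<^esub> inv\<^bsub>?Q\<^esub> (C #> n)" using that h_diff by (simp only: p_def)
    also have "\<dots> = C #> (m \<otimes> inv n)" using M by (simp only: invQ multQ)
    finally show ?thesis using M subgroup.m_closed[OF subgroup_M] by (simp only: p_def simp_thms)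
  qed
  have p_ex: "\<exists>m. p f m" for f
    using h.hom_closed[of f] carQ by (auto simp: p_def)
  have p_zero: "p 0 m \<longleftrightarrow> m \<in> C" for m
  proof -
    have "h 0 = C" using h.hom_one oneQ by simp
    then have "p 0 m \<longleftrightarrow> m \<in> M \<and> C #> \<one> = C #> m"
      using coset_mult_one[OF subgroup.subset[OF C(1)]] by (simp add: p_def)
    also have "\<dots> \<longleftrightarrow> m \<in> M \<and> m \<otimes> inv \<one> \<in> C"
      using coset_eq[of m \<one>] subgroup.one_closed[OF subgroup_M] by auto
    also have "\<dots> \<longleftrightarrow> m \<in> C" using C(2) M_carrier by auto
    finally show ?thesis .
  qed
  have p_b: "p (frag_of i) (b i)" for i using h(2) b by (simp add: p_def)
  have p_one: "p 0 \<one>" using p_zero subgroup.one_closed[OF C(1)] by simp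
  have p_uminus: "p (- f) (inv m)" if "p f m" for f m
    using p_diff[OF p_one that] that M_carrier by (simp add: p_def)
  have p_surj: "\<exists>f. p f m" if "m \<in> M" for m
  proof -
    have "m \<in> generate G (C \<union> range b)" using that gen by (simp add: b_def)
    then show ?thesis
    proof (induction m rule: generate.induct)
      case one
      show ?case using p_one by (rule exI)
    next
      case (incl m)
      then show ?case using p_zero p_b by blast
    next
      case (inv m)
      then have "\<exists>f. p f m" using p_zero p_b by blast
      then obtain f where "p f m" by (elim exE)
      from p_uminus[OF this] show ?case by (rule exI)
    next
      case (eng m n)
      then obtain f g where fg: "p f m" "p g n" by (elim exE)
      then have "m \<in> carrier G" "n \<in> carrier G" using M_carrier by (auto simp: p_def)
      then have "p (f - - g) (m \<otimes> n)" using p_diff[OF fg(1) p_uminus[OF fg(2)]] by simp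
      then show ?case by (rule exI)
    qed
  qed
  have p_cong: "p f n" if "p f m" "n \<in> M" "m \<otimes> inv n \<in> C" for f m n
    using that coset_eq[of m n] by (auto simp: p_def)
  have p_conj: "p (frag_of j * f) (t [^] j \<otimes> m \<otimes> inv (t [^] j))" if "p f m" for f m j
  proof -
    have "\<exists>m. p f m \<and> p (frag_of j * f) (t [^] j \<otimes> m \<otimes> inv (t [^] j))"
      using subset_UNIV
    proof (induction f rule: frag_induction)
      case zero
      have "\<one> \<in> C" "t [^] j \<otimes> \<one> \<otimes> inv (t [^] j) \<in> C" using subgroup.one_closed[OF C(1)] by auto
      then show ?case using p_zero[of \<one>] p_zero[of "t [^] j \<otimes> \<one> \<otimes> inv (t [^] j)"] by auto
    next
      case (one i)
      have "t [^] j \<otimes> b i \<otimes> inv (t [^] j) = b (j + i)"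
        using a M_carrier by (simp add: b_def int_pow_mult group_normalize)
      then show ?case
        using p_b[of i] p_b[of "j + i"] by (intro exI[of _ "b i"]) (simp add: frag_of_mult)
    next
      case (diff f g)
      then obtain m n where mn: "p f m" "p g n" "p (frag_of j * f) (t [^] j \<otimes> m \<otimes> inv (t [^] j))"
        "p (frag_of j * g) (t [^] j \<otimes> n \<otimes> inv (t [^] j))" by blast
      have G: "m \<in> carrier G" "n \<in> carrier G" using mn M_carrier by (auto simp: p_def)
      have "t [^] j \<otimes> (m \<otimes> inv n) \<otimes> inv (t [^] j)
          = (t [^] j \<otimes> m \<otimes> inv (t [^] j)) \<otimes> inv (t [^] j \<otimes> n \<otimes> inv (t [^] j))"
        using G by (simp add: group_normalize)
      then show ?case
        using p_diff[OF mn(1,2)] p_diff[OF mn(3,4)] by (auto simp: right_diff_distrib)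
    qed
    then obtain n where n: "p f n" "p (frag_of j * f) (t [^] j \<otimes> n \<otimes> inv (t [^] j))" by blast
    have M: "m \<in> M" "n \<in> M" "n \<otimes> inv m \<in> C"
      using that n(1) coset_eq[of n m] by (auto simp: p_def)
    have "(t [^] j \<otimes> n \<otimes> inv (t [^] j)) \<otimes> inv (t [^] j \<otimes> m \<otimes> inv (t [^] j))
        = t [^] j \<otimes> (n \<otimes> inv m) \<otimes> inv (t [^] j)"
      using M M_carrier by (simp add: group_normalize)
    then show ?thesis using p_cong[OF n(2) conj_pow[OF M(1)]] conj_C[OF M(3)] by simp
  qed
  have p_M: "m \<in> M" if "p f m" for f m using that by (simp add: p_def)
  show ?thesis
  proof (intro exI[of _ p] conjI allI ballI impI)
    show "m \<in> M" if "p f m" for f m by (rule p_M[OF that])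
    show "\<exists>m. p f m" for f by (rule p_ex)
    show "\<exists>f. p f m" if "m \<in> M" for m by (rule p_surj[OF that])
    show "p 0 m \<longleftrightarrow> m \<in> C" for m by (rule p_zero)
    show "p (f - g) (m \<otimes> inv n)" if "p f m" "p g n" for f g m n by (rule p_diff[OF that])
    show "p (frag_of j * f) (t [^] j \<otimes> m \<otimes> inv (t [^] j))" if "p f m" for f m j by (rule p_conj[OF that])
  qed
qed

text \<open>Let I be the kernel of the presentation.  If b t^k is conjugate to e t^k by y t^j, then modulo C
  the element b differs from the j-th translate of e by the image of a multiple of t^k - 1.
  Since t^k acts trivially modulo t^k - 1, only the remainder of j modulo k matters, and at most
  c k residue classes remain.\<close>

lemma cyclic_module_finite_index:
  assumes C: "subgroup C G" "C \<subseteq> M" "derived G M \<subseteq> C"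
    and conj_C: "\<And>c i. c \<in> C \<Longrightarrow> t [^] (i::int) \<otimes> c \<otimes> inv (t [^] i) \<in> C"
    and a: "a \<in> M"
    and gen: "M = generate G (C \<union> range (\<lambda>i::int. t [^] i \<otimes> a \<otimes> inv (t [^] i)))"
    and c: "bounded_classes G M t c"
  shows "finite_index_in G C M"
proof -
  obtain p where p: "(\<forall>f m. p f m \<longrightarrow> m \<in> M) \<and> (\<forall>f. \<exists>m. p f m) \<and> (\<forall>m\<in>M. \<exists>f. p f m) \<and>
    (\<forall>m. p 0 m \<longleftrightarrow> m \<in> C) \<and>
    (\<forall>f g m n. p f m \<longrightarrow> p g n \<longrightarrow> p (f - g) (m \<otimes> inv n)) \<and>
    (\<forall>f m j. p f m \<longrightarrow> p (frag_of j * f) (t [^] (j::int) \<otimes> m \<otimes> inv (t [^] j)))"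
    by (rule exE[OF laurent_presentation[OF C conj_C a gen]], assumption, rule that)
  note p_M = p[THEN conjunct1, rule_format]
  note p_ex = p[THEN conjunct2, THEN conjunct1, rule_format]
  note p_surj = p[THEN conjunct2, THEN conjunct2, THEN conjunct1, rule_format]
  note p_zero = p[THEN conjunct2, THEN conjunct2, THEN conjunct2, THEN conjunct1, rule_format]
  note p_diff = p[THEN conjunct2, THEN conjunct2, THEN conjunct2, THEN conjunct2, THEN conjunct1, rule_format]
  note p_conj = p[THEN conjunct2, THEN conjunct2, THEN conjunct2, THEN conjunct2, THEN conjunct2, rule_format]
  have p_one: "p 0 \<one>" using p_zero subgroup.one_closed[OF C(1)] by blast
  have p_add: "p (f + g) (m \<otimes> n)" if "p f m" "p g n" for f g m n
    using p_diff[OF that(1) p_diff[OF p_one that(2)]] that p_M M_carrier by (simp add: group_normalize)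
  define I where "I = {f. p f \<one>}"
  have I_iff: "f - g \<in> I \<longleftrightarrow> m \<otimes> inv n \<in> C" if "p f m" "p g n" for f g m n
  proof
    have G: "m \<in> carrier G" "n \<in> carrier G" using that p_M M_carrier by auto
    assume "f - g \<in> I"
    then have "p (f - g) \<one>" by (simp add: I_def)
    from p_diff[OF this p_diff[OF that]] have "\<one> \<otimes> inv (m \<otimes> inv n) \<in> C"
      by (simp only: diff_self p_zero)
    then have "inv (\<one> \<otimes> inv (m \<otimes> inv n)) \<in> C" by (rule subgroup.m_inv_closed[OF C(1)])
    then show "m \<otimes> inv n \<in> C" using G by simp
  next
    have G: "m \<in> carrier G" "n \<in> carrier G" using that p_M M_carrier by auto
    assume "m \<otimes> inv n \<in> C"
    then have "p ((f - g) - 0) ((m \<otimes> inv n) \<otimes> inv (m \<otimes> inv n))"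
      using p_diff[OF p_diff[OF that]] p_zero by blast
    then show "f - g \<in> I" using G by (simp add: I_def)
  qed
  have zI: "zmodule I"
    unfolding zmodule_def using p_one p_diff[of _ \<one> _ \<one>] by (auto simp: I_def)
  have mult_I: "r * f \<in> I" if f: "f \<in> I" for r f
    using subset_UNIV
  proof (induction r rule: frag_induction)
    case (one i)
    then show ?case using p_conj[of f \<one> i] f by (simp add: I_def)
  next
    case (diff r s)
    then show ?case using zmodule_diff[OF zI] by (simp add: left_diff_distrib)
  qed (use zmodule_zero[OF zI] in simp)
  have I: "ring_ideal I" unfolding ring_ideal_def using zI mult_I by blast
  have "finite (range (residue_class I))"
  proof (rule laurent_quotient_finite[OF I, of c])
    fix k :: nat assume k: "k > 0"
    let ?t = "t [^] int k" and ?K = "ideal_plus I (frag_of (int k) - 1)"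
    have K: "ring_ideal ?K" "zmodule ?K"
      using ideal_plus_ideal[OF I] ring_ideal_zmodule by auto
    have kK: "frag_of (int k) - 1 \<in> ?K" using mult_in_ideal_plus[OF I, of _ 1] by simp
    obtain E where E: "finite E" "card E \<le> c" "E \<subseteq> M"
      "\<And>m. m \<in> M \<Longrightarrow> \<exists>e\<in>E. \<exists>x\<in>cyclic_product G M t. m \<otimes> ?t = x \<otimes> (e \<otimes> ?t) \<otimes> inv x"
      using c k unfolding bounded_classes_def by meson
    obtain F where F: "\<And>e. e \<in> E \<Longrightarrow> p (F e) e" using p_surj E(3) by (metis subsetD)
    define Y where "Y = (\<lambda>(j, e). frag_of (int j) * F e) ` ({..<k} \<times> E)"
    have "finite Y" using E(1) by (simp add: Y_def)
    moreover have "card Y \<le> c * k"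
    proof -
      have "card Y \<le> card ({..<k} \<times> E)" unfolding Y_def using E(1) by (intro card_image_le) simp
      then show ?thesis using mult_le_mono1[OF E(2), of k]
        unfolding card_cartesian_product card_lessThan by (simp only: mult.commute)
    qed
    moreover have "\<exists>y\<in>Y. f - y \<in> ?K" for f
    proof -
      obtain b where b: "p f b" using p_ex[of f] by blast
      obtain e x where ex: "e \<in> E" "x \<in> cyclic_product G M t" "b \<otimes> ?t = x \<otimes> (e \<otimes> ?t) \<otimes> inv x"
        using E(4)[OF p_M[OF b]] by (elim bexE)
      obtain y and j :: int where y: "x = y \<otimes> t [^] j" "y \<in> M"
        using ex(2) by (auto simp: cyclic_product_def)
      obtain g where g: "p g y" using p_surj[OF y(2)] by blast
      have G: "b \<in> carrier G" "e \<in> carrier G" "y \<in> carrier G"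
        using p_M[OF b] E(3) ex(1) y(2) M_carrier by auto
      \<comment> \<open>Conjugation by x adds to a translate of e an element of the image of 1 - t^k.\<close>
      let ?b = "y \<otimes> (t [^] j \<otimes> e \<otimes> inv (t [^] j)) \<otimes> inv (?t \<otimes> y \<otimes> inv ?t)"
      have comm: "inv (t [^] j) \<otimes> (?t \<otimes> z) = ?t \<otimes> (inv (t [^] j) \<otimes> z)" if "z \<in> carrier G" for z
      proof -
        have "t [^] (- j) \<otimes> ?t = ?t \<otimes> t [^] (- j)" by (simp add: add.commute flip: int_pow_mult)
        then have "inv (t [^] j) \<otimes> ?t = ?t \<otimes> inv (t [^] j)" by (simp add: int_pow_neg)
        then show ?thesis
          using that m_assoc[of "inv (t [^] j)" ?t z] m_assoc[of ?t "inv (t [^] j)" z] by simp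
      qed
      have "?t \<otimes> inv x = ?t \<otimes> (inv (t [^] j) \<otimes> inv y)"
        using G y by (simp add: inv_mult_group)
      also have "\<dots> = inv (t [^] j) \<otimes> (?t \<otimes> inv y)" using comm G by simp
      finally have "b \<otimes> ?t = ?b \<otimes> ?t"
        unfolding ex(3) using G y by (simp add: group_normalize)
      then have "b = ?b" using G by (subst (asm) r_cancel) auto
      moreover have "p (g + frag_of j * F e - frag_of (int k) * g) ?b"
        using p_diff[OF p_add[OF g p_conj[OF F[OF ex(1)]]] p_conj[OF g]] .
      ultimately have "f - (g + frag_of j * F e - frag_of (int k) * g) \<in> I"
        using I_iff[OF b, of "g + frag_of j * F e - frag_of (int k) * g" b] G
          subgroup.one_closed[OF C(1)] by simp
      then have 1: "f - (g + frag_of j * F e - frag_of (int k) * g) \<in> ?K"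
        using ideal_subset_ideal_plus by blast
      have 2: "g * (frag_of (int k) - 1) \<in> ?K" using ring_ideal_mult[OF K(1) kK] .
      have 3: "frag_of (j mod int k) * F e * (frag_of (int k * (j div int k)) - 1) \<in> ?K"
        using ring_ideal_mult[OF K(1) frag_of_multiple_minus_one[OF K(1) kK]] .
      have "frag_of (j mod int k) * F e * (frag_of (int k * (j div int k)) - 1)
          = frag_of j * F e - frag_of (j mod int k) * F e"
      proof -
        have "frag_of (j mod int k) * F e * frag_of (int k * (j div int k))
            = (frag_of (j mod int k) * frag_of (int k * (j div int k))) * F e"
          by (simp only: mult.assoc mult.commute mult.left_commute)
        also have "\<dots> = frag_of j * F e" by (simp add: frag_of_mult)
        finally show ?thesis by (simp only: right_diff_distrib mult_1_right)
      qed
      with 3 have "frag_of j * F e - frag_of (j mod int k) * F e \<in> ?K" by (simp only:)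
      from zmodule_add[OF K(2) zmodule_diff[OF K(2) 1 2] this]
      have "f - frag_of (j mod int k) * F e \<in> ?K" by (simp add: algebra_simps)
      moreover have "frag_of (j mod int k) * F e \<in> Y"
        unfolding Y_def using ex(1) k by (intro image_eqI[of _ _ "(nat (j mod int k), e)"])
          (auto simp: nat_less_iff)
      ultimately show ?thesis by blast
    qed
    ultimately show "\<exists>Y. finite Y \<and> card Y \<le> c * k \<and> (\<forall>x. \<exists>y\<in>Y. x - y \<in> ?K)" by blast
  qed
  then obtain Z where Z: "finite Z" "\<And>f. \<exists>z\<in>Z. f - z \<in> I"
    using residue_classes_cover[OF zI] by blast
  obtain r where r: "\<And>f. p f (r f)" using p_ex by metis
  have "\<exists>c\<in>C. \<exists>s\<in>r ` Z. m = c \<otimes> s" if m: "m \<in> M" for m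
  proof -
    obtain f where f: "p f m" using p_surj[OF m] by blast
    obtain z where z: "z \<in> Z" "f - z \<in> I" using Z(2) by blast
    have "m \<otimes> inv (r z) \<in> C" using I_iff[OF f r] z(2) by blast
    moreover have "m = (m \<otimes> inv (r z)) \<otimes> r z"
      using m p_M[OF r] M_carrier by (simp add: m_assoc)
    ultimately show ?thesis using z(1) by blast
  qed
  moreover have "r ` Z \<subseteq> M" using p_M[OF r] by blast
  ultimately show ?thesis
    unfolding finite_index_in_def using Z(1) by (intro exI[of _ "r ` Z"]) auto
qed

lemma restrict_cyclic_extension:
  assumes "subgroup B G" "B \<subseteq> M" "\<And>b i. b \<in> B \<Longrightarrow> t [^] (i::int) \<otimes> b \<otimes> inv (t [^] i) \<in> B"
  shows "cyclic_extension G B t"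
proof (intro cyclic_extension.intro stable_subgroup.intro stable_subgroup_axioms.intro
    cyclic_extension_axioms.intro)
  show "t \<otimes> m \<otimes> inv t \<in> B" "inv t \<otimes> m \<otimes> t \<in> B" if "m \<in> B" for m
    using assms(3)[OF that, of 1] assms(3)[OF that, of "-1"] by (simp_all add: int_pow_neg)
qed (use assms(1,2) pow_t_in_M is_group in auto)

text \<open>The generators of the product, stripped of their powers of t, generate M under
  conjugation by t.  Removing one of them at a time from this list, together with its conjugates,
  changes the subgroup that they generate with the derived subgroup by a cyclic module each time.
  Each subgroup reached has finite index in M, so that it inherits the bound on the classes.\<close>

lemma derived_finite_index:
  assumes fg: "fg_subgroup G (cyclic_product G M t)" and c: "bounded_classes G M t c"
  shows "finite_index_in G (derived G M) M"
proof -
  note MG = subgroup.subset[OF subgroup_M]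
  define conjs where "conjs F = (\<Union>a\<in>F. range (\<lambda>i::int. t [^] i \<otimes> a \<otimes> inv (t [^] i)))" for F
  define B where "B F = generate G (derived G M \<union> conjs F)" for F
  have DM: "derived G M \<subseteq> M" using derived_incl[OF order_refl subgroup_M] .
  have conjs_M: "conjs F \<subseteq> M" if "F \<subseteq> M" for F using conj_pow that by (auto simp: conjs_def)
  have gensM: "derived G M \<union> conjs F \<subseteq> M" "derived G M \<union> conjs F \<subseteq> carrier G" if "F \<subseteq> M" for F
    using DM conjs_M[OF that] MG by auto
  have B: "subgroup (B F) G" "B F \<subseteq> M" "derived G M \<subseteq> B F" "F \<subseteq> B F" if F: "F \<subseteq> M" for F
  proof -
    show "subgroup (B F) G" unfolding B_def using generate_is_subgroup[OF gensM(2)[OF F]] .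
    show "B F \<subseteq> M" unfolding B_def using generate_subgroup_incl[OF gensM(1)[OF F] subgroup_M] .
    show "derived G M \<subseteq> B F" unfolding B_def by (auto intro: generate.incl)
    have "a \<in> conjs F" if "a \<in> F" for a
      using that F M_carrier unfolding conjs_def by (intro UN_I[of a] rev_image_eqI[of 0]) auto
    then show "F \<subseteq> B F" unfolding B_def by (auto intro: generate.incl)
  qed
  have conj_B: "t [^] (i::int) \<otimes> b \<otimes> inv (t [^] i) \<in> B F" if F: "F \<subseteq> M" and b: "b \<in> B F" for F b i
  proof (rule generate_conj_closed[OF pow_closed gensM(2)[OF F] B(1)[OF F]])
    show "b \<in> generate G (derived G M \<union> conjs F)" using b by (simp add: B_def)
    fix s assume "s \<in> derived G M \<union> conjs F"
    then show "t [^] i \<otimes> s \<otimes> inv (t [^] i) \<in> B F"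
    proof
      assume "s \<in> derived G M"
      then show ?thesis using conj_derived_closed B(3)[OF F] by blast
    next
      assume "s \<in> conjs F"
      then obtain a and j :: int where a: "a \<in> F" "s = t [^] j \<otimes> a \<otimes> inv (t [^] j)"
        by (auto simp: conjs_def)
      then have "t [^] i \<otimes> s \<otimes> inv (t [^] i) = t [^] (i + j) \<otimes> a \<otimes> inv (t [^] (i + j))"
        using F M_carrier by (auto simp: int_pow_mult group_normalize)
      then have "t [^] i \<otimes> s \<otimes> inv (t [^] i) \<in> conjs F" using a(1) unfolding conjs_def by blast
      then show ?thesis unfolding B_def by (auto intro: generate.incl)
    qed
  qed
  have ext: "cyclic_extension G (B F) t" if "F \<subseteq> M" for F
    by (rule restrict_cyclic_extension[OF B(1,2)[OF that] conj_B[OF that]])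
  obtain S where S: "finite S" "S \<subseteq> carrier G" "cyclic_product G M t = generate G S"
    using fg unfolding fg_subgroup_def by blast
  have "\<exists>m\<in>M. \<exists>i::int. s = m \<otimes> t [^] i" if "s \<in> S" for s
    using generate.incl[OF that, of G] S(3)[symmetric] by (auto simp: cyclic_product_def)
  then obtain \<mu> where \<mu>: "\<And>s. s \<in> S \<Longrightarrow> \<mu> s \<in> M \<and> (\<exists>i::int. s = \<mu> s \<otimes> t [^] i)" by metis
  define F0 where "F0 = \<mu> ` S"
  have F0: "finite F0" "F0 \<subseteq> M" using S(1) \<mu> by (auto simp: F0_def)
  \<comment> \<open>If m = b t^i with m and b in M, then t^i lies in M, so that i = 0 and m = b.\<close>
  have "M \<subseteq> B F0"
  proof
    interpret E: cyclic_extension G "B F0" t by (rule ext[OF F0(2)])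
    have "S \<subseteq> cyclic_product G (B F0) t"
    proof
      fix s assume s: "s \<in> S"
      then have "\<mu> s \<in> B F0" using B(4)[OF F0(2)] by (auto simp: F0_def)
      then show "s \<in> cyclic_product G (B F0) t" using \<mu>[OF s] E.cyclic_product_I by metis
    qed
    then have sub: "cyclic_product G M t \<subseteq> cyclic_product G (B F0) t"
      unfolding S(3) by (rule generate_subgroup_incl[OF _ E.product_subgroup])
    fix m assume m: "m \<in> M"
    then obtain b and i :: int where b: "m = b \<otimes> t [^] i" "b \<in> B F0"
      using sub M_subset_product by (fastforce simp: cyclic_product_def)
    have bM: "b \<in> M" using b(2) B(2)[OF F0(2)] by blast
    have "t [^] i = inv b \<otimes> m" using b(1) M_carrier[OF bM] by (simp add: cancel_left)
    also have "\<dots> \<in> M" using m bM by (intro subgroup.m_closed[OF subgroup_M] subgroup.m_inv_closed[OF subgroup_M])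
    finally have "i = 0" by (rule pow_t_in_M)
    then show "m \<in> B F0" using b M_carrier[OF bM] by simp
  qed
  then have B_F0: "B F0 = M" using B(2)[OF F0(2)] by blast
  have "finite_index_in G (B F) M" if "F \<subseteq> F0" for F
    using that
  proof (induction "card (F0 - F)" arbitrary: F rule: less_induct)
    case less
    show ?case
    proof (cases "F = F0")
      case True
      then show ?thesis using B_F0 finite_index_in_refl[OF subgroup_M] by simp
    next
      case False
      then obtain a where a: "a \<in> F0" "a \<notin> F" using less.prems by blast
      let ?F' = "insert a F"
      have F: "F \<subseteq> M" "?F' \<subseteq> M" "?F' \<subseteq> F0" using a(1) less.prems F0(2) by auto
      have "card (F0 - ?F') < card (F0 - F)"
        using a F0(1) by (intro psubset_card_mono) auto
      then have fi: "finite_index_in G (B ?F') M" using less.hyps F(3) by blast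
      obtain c' where c': "bounded_classes G (B ?F') t c'"
        using bounded_classes_finite_index[OF B(1,2)[OF F(2)] fi ext[OF F(2)] c] by blast
      interpret E: cyclic_extension G "B ?F'" t by (rule ext[OF F(2)])
      have "finite_index_in G (B F) (B ?F')"
      proof (rule E.cyclic_module_finite_index[OF B(1)[OF F(1)] _ _ conj_B[OF F(1)] _ _ c'])
        show sub: "B F \<subseteq> B ?F'" unfolding B_def by (intro mono_generate) (auto simp: conjs_def)
        show "derived G (B ?F') \<subseteq> B F" using mono_derived[OF B(2)[OF F(2)]] B(3)[OF F(1)] by blast
        show aB: "a \<in> B ?F'" using B(4)[OF F(2)] by blast
        let ?c = "range (\<lambda>i::int. t [^] i \<otimes> a \<otimes> inv (t [^] i))"
        show "B ?F' = generate G (B F \<union> ?c)"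
        proof
          have "derived G M \<union> conjs ?F' \<subseteq> B F \<union> ?c"
            using B(3)[OF F(1)] generate.incl[of _ "derived G M \<union> conjs F" G]
            by (auto simp: conjs_def B_def)
          then show "B ?F' \<subseteq> generate G (B F \<union> ?c)" unfolding B_def[of ?F'] by (rule mono_generate)
          have "?c \<subseteq> B ?F'" using conj_B[OF F(2) aB] by blast
          then show "generate G (B F \<union> ?c) \<subseteq> B ?F'"
            using sub by (intro generate_subgroup_incl[OF _ B(1)[OF F(2)]]) auto
        qed
      qed
      then show ?thesis
        using finite_index_in_trans[OF _ fi subgroup.subset[OF B(1)[OF F(1)]] B(2)[OF F(2)] subgroup_M] by blast
    qed
  qed
  from this[of "{}"] have "finite_index_in G (B {}) M" by simp
  moreover have "B {} = derived G M"
    using generate_subgroup_incl[OF order_refl derived_is_subgroup[OF MG]] B(3)[of "{}"]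
    by (auto simp: B_def conjs_def)
  ultimately show ?thesis by simp
qed

end

text \<open>Induction on the derived length: the derived subgroup of M has finite index in M, and
  the product with it is finitely generated by Schreier's lemma and has boundedly many classes
  in each coset.\<close>

lemma (in group) finite_kernel_of_solvable:
  assumes "cyclic_extension G M t" "fg_subgroup G (cyclic_product G M t)" "bounded_classes G M t c"
    "(derived G ^^ n) M = {\<one>}"
  shows "finite M"
  using assms
proof (induction n arbitrary: M c)
  case 0
  then show ?case by simp
next
  case (Suc n)
  interpret cyclic_extension G M t by (rule Suc.prems(1))
  note MG = subgroup.subset[OF subgroup_M]
  let ?D = "derived G M"
  have D: "subgroup ?D G" "?D \<subseteq> M" "finite_index_in G ?D M"
    using derived_is_subgroup[OF MG] derived_incl[OF order_refl subgroup_M]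
      derived_finite_index[OF Suc.prems(2,3)] by auto
  have ext: "cyclic_extension G ?D t"
    by (rule restrict_cyclic_extension[OF D(1,2) conj_derived_closed])
  interpret D: cyclic_extension G ?D t by (rule ext)
  obtain c' where c': "bounded_classes G ?D t c'"
    using bounded_classes_finite_index[OF D ext Suc.prems(3)] by blast
  obtain T where T: "finite T" "T \<subseteq> M"
    "\<forall>x\<in>cyclic_product G M t. \<exists>y\<in>cyclic_product G ?D t. \<exists>s\<in>T. x = y \<otimes> s"
    using finite_index_in_product[OF D ext] by blast
  have sub: "cyclic_product G ?D t \<subseteq> cyclic_product G M t"
    using D(2) by (auto simp: cyclic_product_def)
  have "finite_index_in G (cyclic_product G ?D t) (cyclic_product G M t)"
    unfolding finite_index_in_def using T M_subset_product by blast
  then have "fg_subgroup G (cyclic_product G ?D t)"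
    using schreier[OF Suc.prems(2) D.product_subgroup sub] by blast
  moreover have "(derived G ^^ n) ?D = {\<one>}" using Suc.prems(4) by (simp add: funpow_swap1)
  ultimately have "finite ?D" using Suc.IH[OF ext _ c'] by blast
  then show ?case using finite_index_in_finite[OF D(3)] by blast
qed

section \<open>Coverings by conjugates of virtually cyclic subgroups\<close>

context cyclic_extension
begin

lemma layer_mult:
  assumes "m \<in> M" "n \<in> M"
  shows "\<exists>q\<in>M. (m \<otimes> t [^] (i::int)) \<otimes> (n \<otimes> t [^] j) = q \<otimes> t [^] (i + j)"
proof (rule bexI)
  show "(m \<otimes> t [^] i) \<otimes> (n \<otimes> t [^] j) = (m \<otimes> (t [^] i \<otimes> n \<otimes> inv (t [^] i))) \<otimes> t [^] (i + j)"
    using assms M_carrier by (simp add: group_normalize int_pow_mult)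
  show "m \<otimes> (t [^] i \<otimes> n \<otimes> inv (t [^] i)) \<in> M"
    using subgroup.m_closed[OF subgroup_M assms(1) conj_pow[OF assms(2)]] .
qed

lemma layer_pow:
  assumes "m \<in> M"
  shows "\<exists>q\<in>M. (m \<otimes> t [^] (i::int)) [^] (s::nat) = q \<otimes> t [^] (i * int s)"
proof (induction s)
  case 0
  then show ?case using subgroup.one_closed[OF subgroup_M] by (intro bexI[of _ \<one>]) simp_all
next
  case (Suc s)
  then obtain q where q: "q \<in> M" "(m \<otimes> t [^] i) [^] s = q \<otimes> t [^] (i * int s)" by (elim bexE)
  have "(m \<otimes> t [^] i) [^] Suc s = (q \<otimes> t [^] (i * int s)) \<otimes> (m \<otimes> t [^] i)"
    by (simp only: nat_pow_Suc q(2))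
  moreover have "i * int s + i = i * int (Suc s)" by (simp add: algebra_simps)
  ultimately show ?case using layer_mult[OF q(1) assms, of "i * int s" i] by metis
qed

end

definition virtually_cyclic_subgroup :: "('a, 'b) monoid_scheme \<Rightarrow> 'a set \<Rightarrow> bool" where
  "virtually_cyclic_subgroup G V \<longleftrightarrow>
     subgroup V G \<and> (\<exists>v\<in>V. finite_index_in G (range (\<lambda>i::int. v [^]\<^bsub>G\<^esub> i)) V)"

lemma finite_index_in_powersE:
  assumes "finite_index_in G (range (\<lambda>i::int. v [^]\<^bsub>G\<^esub> i)) V"
  obtains W where "finite W" "W \<subseteq> V"
    "\<forall>x\<in>V. \<exists>i::int. \<exists>w\<in>W. x = v [^]\<^bsub>G\<^esub> i \<otimes>\<^bsub>G\<^esub> w"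
proof -
  obtain W where W: "finite W" "W \<subseteq> V"
    "\<forall>x\<in>V. \<exists>h\<in>range (\<lambda>i::int. v [^]\<^bsub>G\<^esub> i). \<exists>w\<in>W. x = h \<otimes>\<^bsub>G\<^esub> w"
    using assms unfolding finite_index_in_def by (elim exE conjE)
  have "\<exists>i::int. \<exists>w\<in>W. x = v [^]\<^bsub>G\<^esub> i \<otimes>\<^bsub>G\<^esub> w" if "x \<in> V" for x
    using bspec[OF W(3) that] by (elim bexE imageE) auto
  then show thesis using W(1,2) that by simp
qed

text \<open>By the pigeonhole principle two powers of y lie in the same coset of the cyclic group
  generated by v.\<close>

lemma (in group) power_in_finite_index:
  assumes v: "v \<in> carrier G" and V: "subgroup V G"
    and fi: "finite_index_in G (range (\<lambda>i::int. v [^] i)) V" and y: "y \<in> V"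
  shows "\<exists>q>0. \<exists>j::int. y [^] (q::nat) = v [^] j"
proof -
  obtain W where W0: "finite W" "W \<subseteq> V" "\<forall>x\<in>V. \<exists>i::int. \<exists>w\<in>W. x = v [^] i \<otimes> w"
    by (rule finite_index_in_powersE[OF fi])
  note W = W0(1,2) W0(3)[rule_format]
  have VG: "V \<subseteq> carrier G" by (rule subgroup.subset[OF V])
  have yn: "y [^] (n::nat) \<in> V" for n
    using subgroup_int_pow_closed[OF V y, of "int n"] by (simp add: int_pow_int)
  have "\<exists>w\<in>W. \<exists>i::int. y [^] n = v [^] i \<otimes> w" for n :: nat using W(3)[OF yn[of n]] by blast
  then obtain w where w: "\<And>n::nat. w n \<in> W \<and> (\<exists>i::int. y [^] n = v [^] i \<otimes> w n)" by metis
  have "\<not> inj w"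
  proof
    assume "inj w"
    moreover have "range w \<subseteq> W" using w by blast
    ultimately show False using W(1) finite_subset finite_imageD infinite_UNIV_nat by metis
  qed
  then obtain m n where mn: "m < n" "w m = w n"
    unfolding inj_def by (metis linorder_neqE_nat)
  obtain i :: int where i: "y [^] m = v [^] i \<otimes> w m" using w[of m] by blast
  obtain j :: int where j: "y [^] n = v [^] j \<otimes> w n" using w[of n] by blast
  have G: "w n \<in> carrier G" "y \<in> carrier G" using w[of n] W(2) VG y by blast+
  have "y [^] (n - m) \<otimes> y [^] m = y [^] n" using mn(1) G by (simp add: nat_pow_mult)
  then have "(y [^] (n - m) \<otimes> v [^] i) \<otimes> w n = v [^] j \<otimes> w n"
    using i j mn(2) G v by (simp add: m_assoc)
  then have "y [^] (n - m) \<otimes> v [^] i = v [^] j" using G v by (subst (asm) r_cancel) auto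
  then have "y [^] (n - m) = v [^] j \<otimes> inv (v [^] i)"
    using G v by (metis inv_solve_right int_pow_closed nat_pow_closed)
  also have "\<dots> = v [^] (j - i)" using v by (simp add: int_pow_diff)
  finally show ?thesis using mn(1) by (intro exI[of _ "n - m"] conjI exI) auto
qed

context cyclic_extension
begin

text \<open>Let V contain an element y of some coset M t^k with k > 0, and let v generate a cyclic subgroup of
  finite index in V.  A power of y is a power of v and has no nontrivial power in M, so v
  has no nontrivial power in M.  Then the elements of V in M t^k lie in different cosets of the
  cyclic group, and the index is a bound for their number, whatever k is.\<close>

lemma virtually_cyclic_layer:
  assumes "virtually_cyclic_subgroup G V"
  shows "\<exists>d. \<forall>k::nat. k > 0 \<longrightarrow>
    finite {m \<in> M. m \<otimes> t [^] int k \<in> V} \<and> card {m \<in> M. m \<otimes> t [^] int k \<in> V} \<le> d"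
proof -
  obtain v where V: "subgroup V G" "v \<in> V" and fi: "finite_index_in G (range (\<lambda>i::int. v [^] i)) V"
    using assms unfolding virtually_cyclic_subgroup_def by blast
  have VG: "V \<subseteq> carrier G" by (rule subgroup.subset[OF V(1)])
  have v: "v \<in> carrier G" using V(2) VG by blast
  obtain W where W0: "finite W" "W \<subseteq> V" "\<forall>x\<in>V. \<exists>i::int. \<exists>w\<in>W. x = v [^] i \<otimes> w"
    by (rule finite_index_in_powersE[OF fi])
  note W = W0(1,2) W0(3)[rule_format]
  have "finite L \<and> card L \<le> card W"
    if k: "k > 0" and L: "L = {m \<in> M. m \<otimes> t [^] int k \<in> V}" for k :: nat and L
  proof (cases "L = {}")
    case True
    then show ?thesis by simp
  next
    case False
    then obtain m where m: "m \<in> M" "m \<otimes> t [^] int k \<in> V" using L by blast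
    have v_M: "l = 0" if l: "v [^] (l::int) \<in> M" for l
    proof (rule ccontr)
      assume "l \<noteq> 0"
      obtain q and j :: int where q: "q > 0" "(m \<otimes> t [^] int k) [^] (q::nat) = v [^] j"
        using power_in_finite_index[OF v V(1) fi m(2)] by blast
      let ?l = "nat \<bar>l\<bar>"
      have "v [^] (int ?l) \<in> M"
        using l subgroup.m_inv_closed[OF subgroup_M l] v by (cases "l \<ge> 0") (auto simp: int_pow_neg)
      then have "(v [^] int ?l) [^] j \<in> M" by (rule subgroup_int_pow_closed[OF subgroup_M])
      also have "(v [^] int ?l) [^] j = (v [^] j) [^] (int ?l)"
        using v by (simp only: int_pow_pow mult.commute)
      also have "\<dots> = (m \<otimes> t [^] int k) [^] (q * ?l)"
        using m(1) M_carrier by (simp only: q(2)[symmetric] int_pow_int nat_pow_pow m_closed nat_pow_closed t_closed)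
      finally have in_M: "(m \<otimes> t [^] int k) [^] (q * ?l) \<in> M" .
      obtain r where r: "r \<in> M" "(m \<otimes> t [^] int k) [^] (q * ?l) = r \<otimes> t [^] (int k * int (q * ?l))"
        using layer_pow[OF m(1), of "int k" "q * ?l"] by blast
      let ?z = "t [^] (int k * int (q * ?l))"
      have "?z = inv r \<otimes> (r \<otimes> ?z)" using r(1) M_carrier by (simp add: cancel_left)
      also have "\<dots> \<in> M"
        using in_M r subgroup.m_closed[OF subgroup_M subgroup.m_inv_closed[OF subgroup_M r(1)]] by simp
      finally have "int k * int (q * ?l) = 0" by (rule pow_t_in_M)
      then show False using k q(1) \<open>l \<noteq> 0\<close> by simp
    qed
    have "\<exists>w\<in>W. \<exists>i::int. m \<otimes> t [^] int k = v [^] i \<otimes> w" if "m \<in> L" for m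
      using W(3)[of "m \<otimes> t [^] int k"] that L by blast
    then obtain w where w: "\<And>m. m \<in> L \<Longrightarrow> w m \<in> W \<and> (\<exists>i::int. m \<otimes> t [^] int k = v [^] i \<otimes> w m)"
      by metis
    have "inj_on w L"
    proof (rule inj_onI)
      fix m n assume mn: "m \<in> L" "n \<in> L" "w m = w n"
      obtain i where i: "m \<otimes> t [^] int k = v [^] (i::int) \<otimes> w m" using w[OF mn(1)] by blast
      obtain j where j: "n \<otimes> t [^] int k = v [^] (j::int) \<otimes> w n" using w[OF mn(2)] by blast
      have M: "m \<in> M" "n \<in> M" using mn L by auto
      have G: "m \<in> carrier G" "n \<in> carrier G" "w n \<in> carrier G"
        using M M_carrier w[OF mn(2)] W(2) VG by blast+
      have "m \<otimes> inv n = (m \<otimes> t [^] int k) \<otimes> inv (n \<otimes> t [^] int k)"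
        using G by (simp add: group_normalize)
      also have "\<dots> = v [^] i \<otimes> inv (v [^] j)"
        unfolding i j mn(3) using G v by (simp add: group_normalize)
      also have "\<dots> = v [^] (i - j)" using v by (simp add: int_pow_diff)
      finally have *: "m \<otimes> inv n = v [^] (i - j)" .
      have "m \<otimes> inv n \<in> M" using M by (intro subgroup.m_closed[OF subgroup_M] subgroup.m_inv_closed[OF subgroup_M])
      then have "i - j = 0" using v_M by (simp only: *)
      then have "m \<otimes> inv n = \<one>" using * by simp
      then show "m = n" using G by (metis inv_equality inv_inv inv_closed)
    qed
    moreover have "w ` L \<subseteq> W" using w by blast
    ultimately show ?thesis using W(1) by (meson card_inj_on_le inj_on_finite)
  qed
  then show ?thesis by (intro exI[of _ "card W"]) simp
qed

end

lemma (in group) virtually_cyclic_subgroup_conj: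
  assumes V: "virtually_cyclic_subgroup G V" and s: "s \<in> carrier G"
  shows "virtually_cyclic_subgroup G ((\<lambda>x. s \<otimes> x \<otimes> inv s) ` V)"
proof -
  obtain v where V: "subgroup V G" "v \<in> V" and fi: "finite_index_in G (range (\<lambda>i::int. v [^] i)) V"
    using V unfolding virtually_cyclic_subgroup_def by blast
  let ?c = "\<lambda>x. s \<otimes> x \<otimes> inv s"
  have "?c \<in> hom G G" using s by (intro homI) (auto simp: group_normalize)
  then interpret c: group_hom G G ?c by (simp add: group_hom_def group_hom_axioms_def is_group)
  have VG: "V \<subseteq> carrier G" by (rule subgroup.subset[OF V(1)])
  obtain W where W0: "finite W" "W \<subseteq> V" "\<forall>x\<in>V. \<exists>i::int. \<exists>w\<in>W. x = v [^] i \<otimes> w"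
    by (rule finite_index_in_powersE[OF fi])
  note W = W0(1,2) W0(3)[rule_format]
  have "\<exists>i::int. \<exists>w\<in>W. ?c x = ?c v [^] i \<otimes> ?c w" if x: "x \<in> V" for x
  proof -
    obtain i w where iw: "w \<in> W" "x = v [^] (i::int) \<otimes> w" using W(3)[OF x] by blast
    have "v \<in> carrier G" "w \<in> carrier G" using V(2) VG W(2) iw(1) by auto
    then have "?c x = ?c v [^] i \<otimes> ?c w"
      using c.hom_mult[of "v [^] i" w] c.hom_int_pow[of v i] unfolding iw(2) by simp
    then show ?thesis using iw(1) by blast
  qed
  then have "finite_index_in G (range (\<lambda>i::int. ?c v [^] i)) (?c ` V)"
    unfolding finite_index_in_def using W(1,2) by (intro exI[of _ "?c ` W"]) blast
  then show ?thesis
    unfolding virtually_cyclic_subgroup_def using c.subgroup_img_is_subgroup[OF V(1)] V(2) by blast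
qed

definition conjugation_covered :: "('a, 'b) monoid_scheme \<Rightarrow> 'a set set \<Rightarrow> bool" where
  "conjugation_covered G \<V> \<longleftrightarrow> finite \<V> \<and> (\<forall>V\<in>\<V>. virtually_cyclic_subgroup G V) \<and>
     (\<forall>x\<in>carrier G. \<exists>V\<in>\<V>. \<exists>v\<in>V. \<exists>g\<in>carrier G. x = g \<otimes>\<^bsub>G\<^esub> v \<otimes>\<^bsub>G\<^esub> inv\<^bsub>G\<^esub> g)"

text \<open>An element of M t^k is conjugate in G to an element of some V in the family.  The conjugating
  element is the product of an element of the extension and a representative s, so the conjugates of
  the members of the family by the finitely many s contain a representative of every class.\<close>

lemma (in cyclic_extension) bounded_classes_of_cover:
  assumes \<V>: "conjugation_covered G \<V>"
    and fi: "finite_index_in G (cyclic_product G M t) (carrier G)"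
  shows "\<exists>c. bounded_classes G M t c"
proof -
  obtain T where T: "finite T" "T \<subseteq> carrier G"
    "\<And>x. x \<in> carrier G \<Longrightarrow> \<exists>y\<in>cyclic_product G M t. \<exists>s\<in>T. x = y \<otimes> s"
    using fi unfolding finite_index_in_def by blast
  have V: "finite \<V>" "\<And>V. V \<in> \<V> \<Longrightarrow> virtually_cyclic_subgroup G V"
    "\<And>x. x \<in> carrier G \<Longrightarrow> \<exists>V\<in>\<V>. \<exists>v\<in>V. \<exists>g\<in>carrier G. x = g \<otimes> v \<otimes> inv g"
    using \<V> unfolding conjugation_covered_def by auto
  define \<W> where "\<W> = (\<lambda>(s, V). (\<lambda>x. s \<otimes> x \<otimes> inv s) ` V) ` (T \<times> \<V>)"
  have W: "finite \<W>" "\<And>V. V \<in> \<W> \<Longrightarrow> virtually_cyclic_subgroup G V"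
    using T(1,2) V(1,2) virtually_cyclic_subgroup_conj by (auto simp: \<W>_def)
  define L where "L k V = {m \<in> M. m \<otimes> t [^] int k \<in> V}" for k V
  have "\<forall>V\<in>\<W>. \<exists>d. \<forall>k>0. finite (L k V) \<and> card (L k V) \<le> d"
    using virtually_cyclic_layer W(2) unfolding L_def by blast
  then obtain d where d: "\<And>V k. V \<in> \<W> \<Longrightarrow> k > 0 \<Longrightarrow> finite (L k V) \<and> card (L k V) \<le> d V" by metis
  have "bounded_classes G M t (\<Sum>V\<in>\<W>. d V)"
    unfolding bounded_classes_def
  proof (intro allI impI)
    fix k :: nat assume k: "k > 0"
    let ?E = "\<Union>V\<in>\<W>. L k V" and ?t = "t [^] int k"
    have "finite ?E" using W(1) d[OF _ k] by blast
    moreover have "card ?E \<le> (\<Sum>V\<in>\<W>. d V)"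
      using card_UN_le[OF W(1), of "L k"] sum_mono[of \<W> "\<lambda>V. card (L k V)" d] d[OF _ k] by fastforce
    moreover have "?E \<subseteq> M" by (auto simp: L_def)
    moreover have "\<exists>e\<in>?E. \<exists>y\<in>cyclic_product G M t. m \<otimes> ?t = y \<otimes> (e \<otimes> ?t) \<otimes> inv y" if m: "m \<in> M" for m
    proof -
      have mt: "m \<otimes> ?t \<in> carrier G" using m M_carrier by simp
      obtain V v g where v: "V \<in> \<V>" "v \<in> V" "g \<in> carrier G" "m \<otimes> ?t = g \<otimes> v \<otimes> inv g"
        using V(3)[OF mt] by blast
      obtain y s where y: "y \<in> cyclic_product G M t" "s \<in> T" "g = y \<otimes> s" using T(3)[OF v(3)] by blast
      have "subgroup V G" using V(2)[OF v(1)] by (simp add: virtually_cyclic_subgroup_def)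
      then have vG: "v \<in> carrier G" using v(2) subgroup.subset by blast
      have G: "s \<in> carrier G" "y \<in> carrier G" using y T(2) product_carrier by auto
      obtain e where e: "e \<in> M" "inv y \<otimes> (m \<otimes> ?t) \<otimes> inv (inv y) = e \<otimes> ?t"
        using conj_layer[OF subgroup.m_inv_closed[OF product_subgroup y(1)] m] by blast
      have "e \<otimes> ?t = s \<otimes> v \<otimes> inv s"
        unfolding e(2)[symmetric] v(4) y(3) using G vG by (simp add: group_normalize)
      then have "e \<in> ?E"
        using e(1) v(1,2) y(2) unfolding L_def \<W>_def by blast
      moreover have "m \<otimes> ?t = y \<otimes> (e \<otimes> ?t) \<otimes> inv y"
        unfolding e(2)[symmetric] using G mt by (simp add: group_normalize)
      ultimately show ?thesis using y(1) by blast
    qed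
    ultimately show "\<exists>E. finite E \<and> card E \<le> (\<Sum>V\<in>\<W>. d V) \<and> E \<subseteq> M \<and>
        (\<forall>m\<in>M. \<exists>e\<in>E. \<exists>x\<in>cyclic_product G M t. m \<otimes> ?t = x \<otimes> (e \<otimes> ?t) \<otimes> inv x)"
      by (intro exI[of _ ?E]) simp
  qed
  then show ?thesis by blast
qed

section \<open>Solvable groups covered by virtually cyclic subgroups\<close>

lemma (in group) finite_index_powers_of_finite:
  assumes M: "stable_subgroup G M a" and fin: "finite M"
  shows "finite_index_in G (range (\<lambda>i::int. a [^] i)) (cyclic_product G M a)"
proof -
  interpret stable_subgroup G M a by (rule M)
  have "\<exists>h\<in>range (\<lambda>i::int. a [^] i). \<exists>m\<in>M. x = h \<otimes> m" if x: "x \<in> cyclic_product G M a" for x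
  proof -
    obtain m and i :: int where m: "m \<in> M" "x = m \<otimes> a [^] i" using x unfolding cyclic_product_def by blast
    have "x = a [^] i \<otimes> (inv (a [^] i) \<otimes> m \<otimes> a [^] i)"
      using m M_carrier by (simp add: group_normalize)
    then show ?thesis using conj_inv_pow[OF m(1), of i] by blast
  qed
  then show ?thesis
    unfolding finite_index_in_def using fin M_subset_product by blast
qed

lemma (in group) finite_index_of_power_mem:
  assumes M: "stable_subgroup G M a" and i: "a [^] (i::int) \<in> M" "i \<noteq> 0"
  shows "finite_index_in G M (cyclic_product G M a)"
proof -
  interpret stable_subgroup G M a by (rule M)
  let ?T = "(\<lambda>j. a [^] j) ` {0..<\<bar>i\<bar>}"
  have a_i: "a [^] (\<bar>i\<bar> * q) \<in> M" for q
  proof -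
    have "a [^] \<bar>i\<bar> \<in> M"
      using i(1) subgroup.m_inv_closed[OF subgroup_M i(1)] by (cases "i \<ge> 0") (auto simp: int_pow_neg)
    then have "(a [^] \<bar>i\<bar>) [^] q \<in> M" by (rule subgroup_int_pow_closed[OF subgroup_M])
    then show ?thesis by (simp only: int_pow_pow t_closed)
  qed
  have "\<exists>h\<in>M. \<exists>s\<in>?T. x = h \<otimes> s" if x: "x \<in> cyclic_product G M a" for x
  proof -
    obtain m and j :: int where m: "m \<in> M" "x = m \<otimes> a [^] j" using x unfolding cyclic_product_def by blast
    have "a [^] j = a [^] (\<bar>i\<bar> * (j div \<bar>i\<bar>)) \<otimes> a [^] (j mod \<bar>i\<bar>)"
      by (simp add: int_pow_mult[symmetric])
    then have "x = (m \<otimes> a [^] (\<bar>i\<bar> * (j div \<bar>i\<bar>))) \<otimes> a [^] (j mod \<bar>i\<bar>)"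
      using m M_carrier by (simp add: m_assoc)
    moreover have "m \<otimes> a [^] (\<bar>i\<bar> * (j div \<bar>i\<bar>)) \<in> M" by (rule subgroup.m_closed[OF subgroup_M m(1) a_i])
    moreover have "j mod \<bar>i\<bar> \<in> {0..<\<bar>i\<bar>}" using i(2) by simp
    ultimately show ?thesis by blast
  qed
  moreover have "?T \<subseteq> cyclic_product G M a" using pow_in_product by blast
  ultimately show ?thesis unfolding finite_index_in_def by (intro exI[of _ ?T]) simp
qed

text \<open>Adjoin the generators of K to its derived subgroup one by one.  At some step the index
  in K changes from infinite to finite, when an element a is adjoined to a subgroup M.  If a^i with
  nonzero i were in M, then M would have finite index as well.\<close>

lemma (in group) infinite_abelianization_step:
  assumes K: "fg_subgroup G K" and inf: "\<not> finite_index_in G (derived G K) K"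
  obtains M a where "cyclic_extension G M a" "M \<subseteq> K"
    "cyclic_product G M a \<subseteq> K" "finite_index_in G (cyclic_product G M a) K"
proof -
  obtain S where S: "finite S" "S \<subseteq> carrier G" "K = generate G S"
    using K unfolding fg_subgroup_def by blast
  have subK: "subgroup K G" by (rule fg_subgroup_subgroup[OF K])
  have SK: "S \<subseteq> K" unfolding S(3) by (auto intro: generate.incl)
  have DK: "derived G K \<subseteq> K" using derived_incl[OF order_refl subK] .
  define B where "B F = generate G (derived G K \<union> F)" for F
  have B: "subgroup (B F) G" "B F \<subseteq> K" "derived G K \<subseteq> B F" "F \<subseteq> B F" if "F \<subseteq> S" for F
  proof -
    have gens: "derived G K \<union> F \<subseteq> K" using that SK DK by blast
    then have gens': "derived G K \<union> F \<subseteq> carrier G" using subgroup.subset[OF subK] by blast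
    show "subgroup (B F) G" unfolding B_def by (rule generate_is_subgroup[OF gens'])
    show "B F \<subseteq> K" unfolding B_def by (rule generate_subgroup_incl[OF gens subK])
    show "derived G K \<subseteq> B F" "F \<subseteq> B F" unfolding B_def by (auto intro: generate.incl)
  qed
  have "K \<subseteq> B S" using generate_subgroup_incl[OF B(4) B(1)] S(3) by blast
  then have BS: "B S = K" using B(2)[of S] by blast
  have B0: "B {} = derived G K"
    using generate_subgroup_incl[OF order_refl derived_is_subgroup[OF subgroup.subset[OF subK]]] B(3)[of "{}"]
    by (auto simp: B_def)
  \<comment> \<open>If no adjunction changed the index from infinite to finite, then finite index would
      descend from S to the empty set.\<close>
  have "\<exists>F a. F \<subseteq> S \<and> a \<in> S \<and> finite_index_in G (B (insert a F)) K \<and> \<not> finite_index_in G (B F) K"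
  proof (rule ccontr)
    assume *: "\<not> ?thesis"
    have "finite_index_in G (B F) K \<longrightarrow> finite_index_in G (B {}) K" if "F \<subseteq> S" for F
      using finite_subset[OF that S(1)] that
    proof (induction F rule: finite_induct)
      case empty
      then show ?case by simp
    next
      case (insert a F)
      then show ?case using * by auto
    qed
    from this[of S] have "finite_index_in G (derived G K) K"
      unfolding BS B0 using finite_index_in_refl[OF subK] by simp
    then show False using inf by simp
  qed
  then obtain F a where F: "F \<subseteq> S" "a \<in> S" "finite_index_in G (B (insert a F)) K"
    "\<not> finite_index_in G (B F) K" by (elim exE conjE)
  let ?M = "B F"
  have aK: "a \<in> K" "inv a \<in> K" using F(2) SK subgroup.m_inv_closed[OF subK] by auto
  have aG: "a \<in> carrier G" using aK subgroup.subset[OF subK] by blast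
  have st: "stable_subgroup G ?M a"
  proof (intro stable_subgroup.intro stable_subgroup_axioms.intro)
    note conj = conj_in_of_derived_subset[OF subK B(1,2,3)[OF F(1)]]
    show "a \<otimes> m \<otimes> inv a \<in> ?M" "inv a \<otimes> m \<otimes> a \<in> ?M" if "m \<in> ?M" for m
      using conj[OF aK(1) that] conj[OF aK(2) that] aG by simp_all
  qed (use B(1)[OF F(1)] aG is_group in auto)
  interpret stable_subgroup G ?M a by (rule st)
  have sub: "B (insert a F) \<subseteq> cyclic_product G ?M a"
    unfolding B_def[of "insert a F"]
    using B(3,4)[OF F(1)] M_subset_product t_in_product
    by (intro generate_subgroup_incl[OF _ product_subgroup]) auto
  have prodK: "cyclic_product G ?M a \<subseteq> K" by (rule product_minimal[OF subK B(2)[OF F(1)] aK(1)])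
  have fi: "finite_index_in G (cyclic_product G ?M a) K" by (rule finite_index_in_mono[OF F(3) sub])
  have "i = 0" if "a [^] (i::int) \<in> ?M" for i
  proof (rule ccontr)
    assume "i \<noteq> 0"
    from finite_index_in_trans[OF finite_index_of_power_mem[OF st that this] fi _ prodK subK]
    show False using F(4) subgroup.subset[OF subgroup_M] by blast
  qed
  then have "cyclic_extension G ?M a"
    by (intro cyclic_extension.intro[OF st] cyclic_extension_axioms.intro)
  with B(2)[OF F(1)] prodK fi that show thesis by blast
qed

text \<open>Induction on the derived length.  Either K may be replaced by its derived subgroup, or K has
  up to finite index an infinite cyclic quotient, whose kernel is finite.\<close>

lemma (in group) virtually_cyclic_of_solvable_cover:
  assumes \<V>: "conjugation_covered G \<V>"
    and K: "fg_subgroup G K" "finite_index_in G K (carrier G)" "(derived G ^^ n) K = {\<one>}"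
  shows "\<exists>v\<in>carrier G. finite_index_in G (range (\<lambda>i::int. v [^] i)) (carrier G)"
  using K
proof (induction n arbitrary: K)
  case 0
  have "K \<subseteq> range (\<lambda>i::int. \<one> [^] i)" using 0(3) by simp
  then show ?case using finite_index_in_mono[OF 0(2)] one_closed by blast
next
  case (Suc n)
  have subK: "subgroup K G" by (rule fg_subgroup_subgroup[OF Suc.prems(1)])
  have KG: "K \<subseteq> carrier G" by (rule subgroup.subset[OF subK])
  show ?case
  proof (cases "finite_index_in G (derived G K) K")
    case True
    have D: "subgroup (derived G K) G" "derived G K \<subseteq> K"
      using derived_is_subgroup[OF KG] derived_incl[OF order_refl subK] by auto
    have "fg_subgroup G (derived G K)" by (rule schreier[OF Suc.prems(1) D True])
    moreover have "finite_index_in G (derived G K) (carrier G)"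
      using finite_index_in_trans[OF True Suc.prems(2) _ KG subgroup_self] D(2) KG by blast
    moreover have "(derived G ^^ n) (derived G K) = {\<one>}"
      using Suc.prems(3) by (simp add: funpow_swap1)
    ultimately show ?thesis by (rule Suc.IH)
  next
    case False
    obtain M a where Ma: "cyclic_extension G M a" "M \<subseteq> K"
      "cyclic_product G M a \<subseteq> K" "finite_index_in G (cyclic_product G M a) K"
      using infinite_abelianization_step[OF Suc.prems(1) False] by metis
    interpret cyclic_extension G M a by (rule Ma(1))
    let ?P = "cyclic_product G M a"
    have fg: "fg_subgroup G ?P" by (rule schreier[OF Suc.prems(1) product_subgroup Ma(3,4)])
    have fi: "finite_index_in G ?P (carrier G)"
      using finite_index_in_trans[OF Ma(4) Suc.prems(2) _ KG subgroup_self] Ma(3) KG by blast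
    obtain c where c: "bounded_classes G M a c" using bounded_classes_of_cover[OF \<V> fi] by blast
    have "(derived G ^^ Suc n) M \<subseteq> {\<one>}" using mono_exp_of_derived[OF Ma(2), of "Suc n"] Suc.prems(3) by simp
    then have "(derived G ^^ Suc n) M = {\<one>}"
      using subgroup.one_closed[OF exp_of_derived_is_subgroup[OF subgroup_M, of "Suc n"]] by blast
    then have "finite M" using finite_kernel_of_solvable[OF Ma(1) fg c] by blast
    then have "finite_index_in G (range (\<lambda>i::int. a [^] i)) ?P"
      using finite_index_powers_of_finite stable_subgroup_axioms by blast
    then have "finite_index_in G (range (\<lambda>i::int. a [^] i)) (carrier G)"
      by (rule finite_index_in_trans[OF _ fi _ subgroup.subset[OF product_subgroup] subgroup_self]) auto
    then show ?thesis using t_closed by blast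
  qed
qed

section \<open>Reduction of the theorem to coverings\<close>

lemma (in group) finite_rcosets_iff:
  assumes H: "subgroup H G"
  shows "finite (rcosets H) \<longleftrightarrow> finite_index_in G H (carrier G)"
proof
  assume fin: "finite (rcosets H)"
  have "rcosets H = (\<lambda>x. H #> x) ` carrier G" unfolding RCOSETS_def by auto
  then obtain T where T: "T \<subseteq> carrier G" "finite T" "rcosets H = (\<lambda>x. H #> x) ` T"
    using finite_subset_image[OF fin, of "\<lambda>x. H #> x" "carrier G"] by auto
  have "\<exists>h\<in>H. \<exists>t\<in>T. x = h \<otimes> t" if x: "x \<in> carrier G" for x
  proof -
    have "H #> x \<in> rcosets H" using x unfolding RCOSETS_def by blast
    then obtain t where t: "t \<in> T" "H #> x = H #> t" using T(3) by blast
    have "x \<in> H #> t" using rcos_self[OF x H] t(2) by simp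
    then show ?thesis using t(1) unfolding r_coset_def by blast
  qed
  then show "finite_index_in G H (carrier G)" unfolding finite_index_in_def using T(1,2) by blast
next
  assume "finite_index_in G H (carrier G)"
  then obtain T where T: "finite T" "T \<subseteq> carrier G" "\<forall>x\<in>carrier G. \<exists>h\<in>H. \<exists>t\<in>T. x = h \<otimes> t"
    unfolding finite_index_in_def by blast
  have "rcosets H \<subseteq> (\<lambda>t. H #> t) ` T"
  proof
    fix C assume "C \<in> rcosets H"
    then obtain x where x: "x \<in> carrier G" "C = H #> x" unfolding RCOSETS_def by blast
    obtain h t where ht: "h \<in> H" "t \<in> T" "x = h \<otimes> t" using T(3) x(1) by blast
    have "x \<in> H #> t" using ht unfolding r_coset_def by blast
    then have "H #> t = H #> x" using repr_independence[OF _ _ H] ht(2) T(2) by blast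
    then show "C \<in> (\<lambda>t. H #> t) ` T" using x(2) ht(2) by blast
  qed
  then show "finite (rcosets H)" using T(1) finite_subset by blast
qed

lemma (in group) powers_subgroup: "v \<in> carrier G \<Longrightarrow> subgroup (range (\<lambda>i::int. v [^] i)) G"
  using generate_is_subgroup[of "{v}"] generate_pow[of v] by (simp add: full_SetCompr_eq)

lemma (in group) virtually_cyclic_iff:
  "virtually_cyclic G \<longleftrightarrow> (\<exists>v\<in>carrier G. finite_index_in G (range (\<lambda>i::int. v [^] i)) (carrier G))"
proof
  assume "virtually_cyclic G"
  then obtain C where C: "subgroup C G" "finite (rcosets C)" "cyclic_group (G\<lparr>carrier := C\<rparr>)"
    unfolding virtually_cyclic_def finite_index_def by blast
  interpret C: group "G\<lparr>carrier := C\<rparr>" by (rule subgroup_imp_group[OF C(1)])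
  obtain v where v: "v \<in> C" "C = range (\<lambda>i::int. v [^]\<^bsub>G\<lparr>carrier := C\<rparr>\<^esub> i)"
    using C(3) C.cyclic_group by auto
  have "C = range (\<lambda>i::int. v [^] i)" using v int_pow_consistent[OF C(1) v(1)] by simp
  moreover have "finite_index_in G C (carrier G)" using C(1,2) finite_rcosets_iff by blast
  moreover have "v \<in> carrier G" using v(1) subgroup.subset[OF C(1)] by blast
  ultimately show "\<exists>v\<in>carrier G. finite_index_in G (range (\<lambda>i::int. v [^] i)) (carrier G)" by auto
next
  assume "\<exists>v\<in>carrier G. finite_index_in G (range (\<lambda>i::int. v [^] i)) (carrier G)"
  then obtain v where v: "v \<in> carrier G" "finite_index_in G (range (\<lambda>i::int. v [^] i)) (carrier G)" by blast
  define C where "C = range (\<lambda>i::int. v [^] i)"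
  have C: "subgroup C G" unfolding C_def by (rule powers_subgroup[OF v(1)])
  interpret C: group "G\<lparr>carrier := C\<rparr>" by (rule subgroup_imp_group[OF C])
  have vC: "v \<in> C" unfolding C_def using int_pow_1[OF v(1)] by (metis rangeI)
  have "C = range (\<lambda>i::int. v [^]\<^bsub>G\<lparr>carrier := C\<rparr>\<^esub> i)"
    by (subst C_def, rule image_cong[OF refl]) (rule int_pow_consistent[OF C vC])
  then have "\<exists>v\<in>C. C = range (\<lambda>i::int. v [^]\<^bsub>G\<lparr>carrier := C\<rparr>\<^esub> i)" using vC by (rule bexI)
  moreover have "carrier (G\<lparr>carrier := C\<rparr>) = C" by simp
  ultimately have "cyclic_group (G\<lparr>carrier := C\<rparr>)" unfolding C.cyclic_group by (simp only:)
  moreover have "finite (rcosets C)" using v(2) finite_rcosets_iff[OF C] by (simp add: C_def)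
  ultimately show "virtually_cyclic G"
    unfolding virtually_cyclic_def finite_index_def using C by (intro exI[of _ C] conjI)
qed

lemma (in group) vc_subgroups_iff: "V \<in> vc_subgroups G \<longleftrightarrow> virtually_cyclic_subgroup G V"
proof (cases "subgroup V G")
  case True
  interpret V: group "G\<lparr>carrier := V\<rparr>" by (rule subgroup_imp_group[OF True])
  have "finite_index_in (G\<lparr>carrier := V\<rparr>) A V = finite_index_in G A V" for A
    by (simp add: finite_index_in_def)
  then show ?thesis
    unfolding vc_subgroups_def virtually_cyclic_subgroup_def
    using True V.virtually_cyclic_iff int_pow_consistent[OF True] by auto
qed (auto simp: vc_subgroups_def virtually_cyclic_subgroup_def)

text \<open>Otherwise iterating a choice of strictly larger virtually cyclic subgroups yields an ascending chain
  that does not stabilise.\<close>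

lemma (in group) contained_in_maximal_vc:
  assumes mx: "max_condition_vc G" and C: "C \<in> vc_subgroups G"
  shows "\<exists>V\<in>maximal_vc_subgroups G. C \<subseteq> V"
proof (rule ccontr)
  assume no: "\<not> ?thesis"
  have "\<exists>K\<in>vc_subgroups G. V \<subset> K" if "V \<in> vc_subgroups G" "C \<subseteq> V" for V
  proof -
    have "V \<notin> maximal_vc_subgroups G" using no that(2) by blast
    with that(1) obtain K where "K \<in> vc_subgroups G" "V \<subseteq> K" "K \<noteq> V"
      by (auto simp: maximal_vc_subgroups_def)
    then show ?thesis by (intro bexI[of _ K]) auto
  qed
  then obtain nxt where nxt:
    "\<And>V. V \<in> vc_subgroups G \<Longrightarrow> C \<subseteq> V \<Longrightarrow> nxt V \<in> vc_subgroups G \<and> V \<subset> nxt V" by metis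
  define K where "K n = (nxt ^^ n) C" for n
  have K: "K n \<in> vc_subgroups G \<and> C \<subseteq> K n" for n
  proof (induction n)
    case 0
    then show ?case using C by (simp add: K_def)
  next
    case (Suc n)
    then show ?case using nxt[of "K n"] by (auto simp: K_def)
  qed
  have step: "K n \<subset> K (Suc n)" for n using nxt[of "K n"] K[of n] by (simp add: K_def)
  have "\<exists>m. \<forall>n\<ge>m. K n = K m"
    using mx[unfolded max_condition_vc_def, THEN spec, of K] K psubset_imp_subset[OF step] by simp
  then obtain m where m: "\<forall>n\<ge>m. K n = K m" by (elim exE)
  have "K (Suc m) = K m" by (rule m[rule_format]) simp
  then show False using step[of m] by blast
qed

text \<open>A representative of each conjugacy class of maximal virtually cyclic subgroups suffices, since
  every element lies in a maximal one.\<close>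

lemma (in group) conjugation_covered_of_finite_classes:
  assumes mx: "max_condition_vc G"
    and fin: "finite (conjugacy_class G ` maximal_vc_subgroups G)"
  shows "\<exists>\<V>. conjugation_covered G \<V>"
proof -
  obtain \<V> where \<V>: "\<V> \<subseteq> maximal_vc_subgroups G" "finite \<V>"
    "conjugacy_class G ` maximal_vc_subgroups G = conjugacy_class G ` \<V>"
    using finite_subset_image[OF fin order_refl] by auto
  have "\<exists>V\<in>\<V>. \<exists>v\<in>V. \<exists>g\<in>carrier G. x = g \<otimes> v \<otimes> inv g" if x: "x \<in> carrier G" for x
  proof -
    let ?C = "range (\<lambda>i::int. x [^] i)"
    have C: "subgroup ?C G" by (rule powers_subgroup[OF x])
    have xC: "x \<in> ?C" using int_pow_1[OF x] by (metis rangeI)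
    have "?C \<in> vc_subgroups G"
      unfolding vc_subgroups_iff virtually_cyclic_subgroup_def using C xC finite_index_in_refl[OF C] by blast
    then obtain M where M: "M \<in> maximal_vc_subgroups G" "?C \<subseteq> M" using contained_in_maximal_vc[OF mx] by blast
    have MG: "M \<subseteq> carrier G"
      using M(1) subgroup.subset by (auto simp: maximal_vc_subgroups_def vc_subgroups_def)
    obtain V where V: "V \<in> \<V>" "conjugacy_class G M = conjugacy_class G V" using \<V>(3) M(1) by (metis imageE imageI)
    have "\<one> <# M #> inv \<one> = M" using MG by (simp add: lcos_mult_one)
    then have "M \<in> conjugacy_class G M"
      unfolding conjugacy_class_def by (intro CollectI exI[of _ \<one>]) simp
    then have "M \<in> conjugacy_class G V" by (simp only: V(2))
    then obtain g where g: "g \<in> carrier G" "M = g <# V #> inv g" unfolding conjugacy_class_def by blast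
    have "x \<in> g <# V #> inv g" using xC M(2) g(2) by blast
    then obtain v where "v \<in> V" "x = g \<otimes> v \<otimes> inv g" unfolding l_coset_def r_coset_def by blast
    then show ?thesis using V(1) g(1) by blast
  qed
  moreover have "virtually_cyclic_subgroup G V" if "V \<in> \<V>" for V
    using that \<V>(1) vc_subgroups_iff by (auto simp: maximal_vc_subgroups_def)
  ultimately show ?thesis unfolding conjugation_covered_def using \<V>(2) by blast
qed

text \<open>Each commutator of two elements of a term of the derived series is a commutator of an element
  of that term with an element of N.\<close>

lemma (in group) derived_series_le_lower_central:
  assumes N: "subgroup N G"
  shows "(derived G ^^ n) N \<subseteq> lower_central (G\<lparr>carrier := N\<rparr>) n"
proof (induction n)
  case 0
  then show ?case by simp
next
  case (Suc n)
  let ?N = "G\<lparr>carrier := N\<rparr>" and ?D = "(derived G ^^ n) N"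
  interpret N: group ?N by (rule subgroup_imp_group[OF N])
  have DN: "?D \<subseteq> N"
  proof (induction n)
    case (Suc n)
    then show ?case using derived_incl[OF _ N] by simp
  qed simp
  have "derived_set G ?D = derived_set ?N ?D" using derived_set_consistent[OF DN N] by simp
  also have "\<dots> \<subseteq> (\<Union>x\<in>lower_central ?N n. \<Union>y\<in>carrier ?N.
       {x \<otimes>\<^bsub>?N\<^esub> y \<otimes>\<^bsub>?N\<^esub> inv\<^bsub>?N\<^esub> x \<otimes>\<^bsub>?N\<^esub> inv\<^bsub>?N\<^esub> y})"
    using Suc.IH DN by auto
  finally have "generate ?N (derived_set G ?D) \<subseteq> lower_central ?N (Suc n)"
    unfolding lower_central.simps by (rule N.mono_generate)
  moreover have "generate ?N (derived_set G ?D) = generate G (derived_set G ?D)"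
    by (rule generate_consistent[OF derived_set_incl[OF DN N] N])
  moreover have "derived G ?D = generate G (derived_set G ?D)" by (rule derived_def)
  ultimately show ?case by simp
qed

lemma (in group) solvable_of_nilpotent_by_abelian:
  assumes H: "subgroup H G" and na: "nilpotent_by_abelian (G\<lparr>carrier := H\<rparr>)"
  shows "\<exists>n. (derived G ^^ n) H = {\<one>}"
proof -
  let ?H = "G\<lparr>carrier := H\<rparr>"
  interpret H: group ?H by (rule subgroup_imp_group[OF H])
  obtain N n where N: "N \<lhd> ?H" "lower_central (G\<lparr>carrier := N\<rparr>) n = {\<one>}" "comm_group (?H Mod N)"
    using na unfolding nilpotent_by_abelian_def nilpotent_group_def by auto
  have subN: "subgroup N G" using N(1) H normal_imp_subgroup incl_subgroup by blast
  have "derived G H \<subseteq> N" by (rule derived_of_subgroup_minimal[OF N(1) H N(3)])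
  then have "(derived G ^^ Suc n) H \<subseteq> (derived G ^^ n) N"
    using mono_exp_of_derived[of "derived G H" N n] by (simp add: funpow_swap1)
  also have "\<dots> \<subseteq> {\<one>}" using derived_series_le_lower_central[OF subN, of n] N(2) by simp
  finally have "(derived G ^^ Suc n) H \<subseteq> {\<one>}" .
  moreover have "\<one> \<in> (derived G ^^ Suc n) H"
    by (rule subgroup.one_closed[OF exp_of_derived_is_subgroup[OF H]])
  ultimately show ?thesis by blast
qed

theorem theorem4p6:
  fixes G :: "('a, 'b) monoid_scheme"
  assumes "group G"
    and "finitely_generated G"
    and "nilpotent_by_abelian_by_finite G"
    and "max_condition_vc G"
    and "finite (conjugacy_class G ` maximal_vc_subgroups G)"
  shows "virtually_cyclic G"
proof -
  interpret group G by (rule assms(1))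
  obtain H where H: "finite_index H G" "nilpotent_by_abelian (G\<lparr>carrier := H\<rparr>)"
    using assms(3) unfolding nilpotent_by_abelian_by_finite_def by blast
  have subH: "subgroup H G" and fiH: "finite_index_in G H (carrier G)"
    using H(1) finite_rcosets_iff unfolding finite_index_def by auto
  have "fg_subgroup G (carrier G)"
    using assms(2) unfolding finitely_generated_def fg_subgroup_def by auto
  then have "fg_subgroup G H" by (rule schreier[OF _ subH subgroup.subset[OF subH] fiH])
  moreover obtain n where "(derived G ^^ n) H = {\<one>\<^bsub>G\<^esub>}"
    using solvable_of_nilpotent_by_abelian[OF subH H(2)] by blast
  moreover obtain \<V> where "conjugation_covered G \<V>"
    using conjugation_covered_of_finite_classes[OF assms(4,5)] by blast
  ultimately show ?thesis
    unfolding virtually_cyclic_iff using virtually_cyclic_of_solvable_cover[OF _ _ fiH] by blast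
qed

end
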